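(* Assume the game and the gradient noise satisfy the standing assumptions (i)–(vi) given in the context. Consider the median-of-means algorithm described in the context with step sizes $\alpha_k = b(k+1)^{-a}$ for some $a\in(0,1]$ and $b>0$, and sample sizes $m_k = c\lceil (k+1)^\beta\rceil$ with any $\beta>0$ and integer $c\ge 1$. Let the block parameters be $$b_k=\Big\lfloor \min\big\{8\ln(e^{1/8}\gamma_k^{-1}),\ \tfrac{m_k}{2}\big\}\Big\rfloor,\qquad s_k=\Big\lfloor \frac{m_k}{b_k}\Big\rfloor,\qquad \gamma_k=\frac{1}{(k+1)^2}.$$ Then the sequence of action profiles $\{\mathbf{x}_k\}$ generated by the algorithm converges almost surely to the unique Nash equilibrium $x^*$, i.e. $\lim_{k\to\infty}\|\mathbf{x}_k-x^*\|=0$ almost surely.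
   Context: **Game.** There are $N>1$ players. Player $i\in\{1,\dots,N\}$ chooses $x_i\in\Omega_i\subseteq\mathbb{R}$ to minimize $J_i(x_i,x_{-i}):=\mathbb{E}_{\xi_i}[f_i(x_i,x_{-i},\xi_i)]$, where $x_{-i}\in\Omega_{-i}:=\prod_{j\ne i}\Omega_j$ is the vector of the other players' actions and $\xi_i$ is a real random variable. Write $J_i(x)=J_i(x_i,x_{-i})$ and $\Omega=\Omega_1\times\cdots\times\Omega_N$; $f_i$ and $J_i$ are defined on an open set containing $\Omega$ in the variable $x$, so that the derivatives below make sense on $\Omega$. A Nash equilibrium is $x^*\in\Omega$ with $J_i(x_i^*,x_{-i}^* )\le J_i(x_i,x_{-i}^* )$ for all $x_i\in\Omega_i$ and all $i$. $\|\cdot\|$ is the Euclidean norm and $\mathbb{P}_{\Omega_i}[\cdot]$ is Euclidean projection onto $\Omega_i$. The pseudo-gradient is $F(x):=[\nabla_{x_1}J_1(x),\dots,\nabla_{x_N}J_N(x)]^\top\in\mathbb{R}^N$. **Algorithm.** Start from $\mathbf{x}_0\in\Omega$. At step $k=0,1,2,\dots$, with $\mathbf{x}_k=[x_{1,k},\dots,x_{N,k}]^\top$, each player $i$: (1) draws $m_k$ i.i.d. samples $\xi_{i,k}^1,\dots,\xi_{i,k}^{m_k}$ of $\xi_i$, independent of the past, and computes $g_{i,k}^j=\nabla_{x_i}f_i(\mathbf{x}_k,\xi_{i,k}^j)$; (2) forms $b_k$ disjoint blocks $B_1,\dots,B_{b_k}$ of sample indices, each of size $s_k$ (leftover samples are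 unused), and computes $\bar g_{i,k}^\ell=\frac1{s_k}\sum_{j\in B_\ell}g_{i,k}^j$; (3) computes $\hat g_{i,k}=\operatorname{median}\{\bar g_{i,k}^1,\dots,\bar g_{i,k}^{b_k}\}$ (the average of the two middle values if $b_k$ is even); (4) sets $x_{i,k+1}=\mathbb{P}_{\Omega_i}[x_{i,k}-\alpha_k\hat g_{i,k}]$. If the formula for $b_k$ gives $0$ (which happens only when $m_k=1$, i.e. $k=0$, $c=1$), take $b_k=s_k=1$. **Standing assumptions.** Let $\mathcal{F}_k$ be the $\sigma$-algebra containing all randomness up to step $k-1$ (so $\mathbf{x}_k$ is $\mathcal{F}_k$-measurable), and let $\epsilon_{i,k}^j=g_{i,k}^j-\nabla_{x_i}J_i(\mathbf{x}_k)$. (i) $\Omega$ is nonempty, convex and compact. (ii) Each $J_i$ is continuously differentiable, and convex in $x_i$ for every fixed $x_{-i}\in\Omega_{-i}$. (iii) $F$ is strongly monotone with modulus $\mu>0$: $(F(x)-F(y))^\top(x-y)\ge\mu\|x-y\|^2$ for all $x,y\in\Omega$. (iv) $F$ is $L$-Lipschitz for some $L>0$: $\|F(x)-F(y)\|\le L\|x-y\|$ for all $x,y\in\Omega$. (v) For all $i$, $k\ge0$, $j$: $\mathbb{E}[\epsilon_{i,k}^j\mid\mathcal{F}_k]=0$ a.s. (vi) There exist $1<\delta\le2$ and $\nu>0$ with $\mathbb{E}[|\epsilon_{i,k}^j|^\delta\mid\mathcal{F}_k]\le\nu^\delta$ a.s. for all $i,k,j$. Under (i)–(iii) there is a unique Nash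 equilibrium $x^*$. *)

theory Defs
  imports "HOL-Probability.Probability"
begin

definition action_profiles :: "('n::finite \<Rightarrow> real set) \<Rightarrow> (real^'n) set" where
  "action_profiles \<Omega> = {x. \<forall>i. x $ i \<in> \<Omega> i}"

text \<open>The profile \<open>(t, x\<^sub>-\<^sub>i)\<close>: player \<open>i\<close> plays \<open>t\<close>, all others play as in \<open>x\<close>.\<close>

definition deviate :: "real^'n \<Rightarrow> 'n \<Rightarrow> real \<Rightarrow> real^'n" where
  "deviate x i t = (\<chi> j. if j = i then t else x $ j)"

definition partial_deriv :: "(real^'n \<Rightarrow> real) \<Rightarrow> 'n \<Rightarrow> real^'n \<Rightarrow> real" where
  "partial_deriv h i x = deriv (\<lambda>t. h (deviate x i t)) (x $ i)"

definition cost ::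
  "'w measure \<Rightarrow> ('n \<Rightarrow> real^'n \<Rightarrow> real \<Rightarrow> real) \<Rightarrow> ('n \<Rightarrow> 'w \<Rightarrow> real) \<Rightarrow> 'n \<Rightarrow> real^'n \<Rightarrow> real" where
  "cost M f \<xi> i x = prob_space.expectation M (\<lambda>\<omega>. f i x (\<xi> i \<omega>))"

definition pseudo_gradient :: "('n \<Rightarrow> real^'n \<Rightarrow> real) \<Rightarrow> real^'n \<Rightarrow> real^'n" where
  "pseudo_gradient J x = (\<chi> i. partial_deriv (J i) i x)"

definition nash_equilibrium ::
  "('n::finite \<Rightarrow> real set) \<Rightarrow> ('n \<Rightarrow> real^'n \<Rightarrow> real) \<Rightarrow> real^'n \<Rightarrow> bool" where
  "nash_equilibrium \<Omega> J x \<longleftrightarrow>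
     x \<in> action_profiles \<Omega> \<and> (\<forall>i. \<forall>t\<in>\<Omega> i. J i x \<le> J i (deviate x i t))"

definition continuously_differentiable_on ::
  "(real^'n) set \<Rightarrow> (real^'n::finite \<Rightarrow> real) \<Rightarrow> bool" where
  "continuously_differentiable_on U h \<longleftrightarrow>
     (\<exists>G. continuous_on U G \<and> (\<forall>x\<in>U. GDERIV h x :> G x))"

definition strongly_monotone_on ::
  "real \<Rightarrow> 'a::real_inner set \<Rightarrow> ('a \<Rightarrow> 'a) \<Rightarrow> bool" where
  "strongly_monotone_on \<mu> S F \<longleftrightarrow>
     (\<forall>x\<in>S. \<forall>y\<in>S. (F x - F y) \<bullet> (x - y) \<ge> \<mu> * (norm (x - y))\<^sup>2)"

definition step_size :: "real \<Rightarrow> real \<Rightarrow> nat \<Rightarrow> real" where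
  "step_size a b k = b * (real k + 1) powr (- a)"

definition sample_size :: "nat \<Rightarrow> real \<Rightarrow> nat \<Rightarrow> nat" where
  "sample_size c \<beta> k = c * nat \<lceil>(real k + 1) powr \<beta>\<rceil>"

definition failure_level :: "nat \<Rightarrow> real" where
  "failure_level k = 1 / (real k + 1)\<^sup>2"

definition raw_num_blocks :: "nat \<Rightarrow> real \<Rightarrow> nat \<Rightarrow> nat" where
  "raw_num_blocks c \<beta> k =
     nat \<lfloor>min (8 * ln (exp (1/8) * inverse (failure_level k))) (real (sample_size c \<beta> k) / 2)\<rfloor>"

text \<open>The raw value is \<open>0\<close> only for \<open>k = 0\<close> and \<open>c = 1\<close>, where there is a single sample;
  one block of size one is used in that case.\<close>

definition num_blocks :: "nat \<Rightarrow> real \<Rightarrow> nat \<Rightarrow> nat" where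
  "num_blocks c \<beta> k = (if raw_num_blocks c \<beta> k = 0 then 1 else raw_num_blocks c \<beta> k)"

definition block_size :: "nat \<Rightarrow> real \<Rightarrow> nat \<Rightarrow> nat" where
  "block_size c \<beta> k =
     (if raw_num_blocks c \<beta> k = 0 then 1
      else nat \<lfloor>real (sample_size c \<beta> k) / real (raw_num_blocks c \<beta> k)\<rfloor>)"

text \<open>\<open>B l\<close> is the set of sample indices in block \<open>l\<close>; samples and blocks are numbered from \<open>0\<close>.\<close>

definition valid_blocks :: "nat \<Rightarrow> nat \<Rightarrow> nat \<Rightarrow> (nat \<Rightarrow> nat set) \<Rightarrow> bool" where
  "valid_blocks m n s B \<longleftrightarrow>
     (\<forall>l<n. B l \<subseteq> {..<m} \<and> card (B l) = s) \<and> disjoint_family_on B {..<n}"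

definition median :: "real list \<Rightarrow> real" where
  "median xs = (let ys = sort xs; n = length xs in
     if odd n then ys ! (n div 2) else (ys ! (n div 2 - 1) + ys ! (n div 2)) / 2)"

definition sample_gradient ::
  "('n \<Rightarrow> real^'n \<Rightarrow> real \<Rightarrow> real) \<Rightarrow> 'n \<Rightarrow> real^'n \<Rightarrow> real \<Rightarrow> real" where
  "sample_gradient f i x z = partial_deriv (\<lambda>y. f i y z) i x"

definition median_of_means :: "nat \<Rightarrow> nat \<Rightarrow> (nat \<Rightarrow> nat set) \<Rightarrow> (nat \<Rightarrow> real) \<Rightarrow> real" where
  "median_of_means n s B g = median (map (\<lambda>l. (\<Sum>j\<in>B l. g j) / real s) [0..<n])"

text \<open>Here \<open>\<zeta> i k j\<close> is the \<open>j\<close>-th sample drawn by player \<open>i\<close> at step \<open>k\<close>, \<open>B i k l\<close> the \<open>l\<close>-th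
  of the \<open>n k\<close> blocks, each of size \<open>s k\<close>, used by player \<open>i\<close> at step \<open>k\<close>, and \<open>\<alpha> k\<close> the step size.\<close>

primrec iterates ::
  "('n::finite \<Rightarrow> real set) \<Rightarrow> ('n \<Rightarrow> real^'n \<Rightarrow> real \<Rightarrow> real) \<Rightarrow> (nat \<Rightarrow> real) \<Rightarrow>
   (nat \<Rightarrow> nat) \<Rightarrow> (nat \<Rightarrow> nat) \<Rightarrow> ('n \<Rightarrow> nat \<Rightarrow> nat \<Rightarrow> nat set) \<Rightarrow>
   ('n \<Rightarrow> nat \<Rightarrow> nat \<Rightarrow> 'w \<Rightarrow> real) \<Rightarrow> real^'n \<Rightarrow> nat \<Rightarrow> 'w \<Rightarrow> real^'n" where
  "iterates \<Omega> f \<alpha> n s B \<zeta> x0 0 \<omega> = x0"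
| "iterates \<Omega> f \<alpha> n s B \<zeta> x0 (Suc k) \<omega> =
     (let x = iterates \<Omega> f \<alpha> n s B \<zeta> x0 k \<omega> in
      \<chi> i. closest_point (\<Omega> i)
             (x $ i - \<alpha> k * median_of_means (n k) (s k) (B i k)
                               (\<lambda>j. sample_gradient f i x (\<zeta> i k j \<omega>))))"

text \<open>The \<open>\<sigma>\<close>-algebra generated by the real random variables \<open>X p\<close> with \<open>p \<in> I\<close>.\<close>

definition generated_by :: "'w measure \<Rightarrow> ('p \<Rightarrow> 'w \<Rightarrow> real) \<Rightarrow> 'p set \<Rightarrow> 'w measure" where
  "generated_by M X I =
     sigma (space M) {X p -` A \<inter> space M | p A. p \<in> I \<and> A \<in> sets borel}"

text \<open>All samples drawn, by any player, at the steps before \<open>k\<close>.\<close>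

definition past ::
  "'w measure \<Rightarrow> (nat \<Rightarrow> nat) \<Rightarrow> ('n \<Rightarrow> nat \<Rightarrow> nat \<Rightarrow> 'w \<Rightarrow> real) \<Rightarrow> nat \<Rightarrow> 'w measure" where
  "past M m \<zeta> k = generated_by M (\<lambda>(i, t, j). \<zeta> i t j) {(i, t, j). t < k \<and> j < m t}"

text \<open>At step \<open>k\<close>, player \<open>i\<close> draws \<open>m k\<close> i.i.d. copies of \<open>\<xi> i\<close>, jointly independent of the past.
  Nothing is said about the dependence between the samples of different players at the same step.\<close>

definition fresh_samples ::
  "'w measure \<Rightarrow> ('n \<Rightarrow> 'w \<Rightarrow> real) \<Rightarrow> (nat \<Rightarrow> nat) \<Rightarrow> ('n \<Rightarrow> nat \<Rightarrow> nat \<Rightarrow> 'w \<Rightarrow> real) \<Rightarrow> bool" where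
  "fresh_samples M \<xi> m \<zeta> \<longleftrightarrow>
     (\<forall>i k. (\<forall>j<m k. \<zeta> i k j \<in> borel_measurable M \<and> distr M borel (\<zeta> i k j) = distr M borel (\<xi> i)) \<and>
            prob_space.indep_vars M (\<lambda>_. borel) (\<zeta> i k) {..<m k} \<and>
            prob_space.indep_set M (sets (past M m \<zeta> k)) (sets (generated_by M (\<zeta> i k) {..<m k})))"

end

theory Submission
  imports Defs "HOL-Real_Asymp.Real_Asymp"
begin

text \<open>Convergence is a deterministic consequence of vanishing gradient errors, and the errors vanish by
concentration and the Borel-Cantelli lemma.

By convexity, a profile \<open>xs\<close> is a Nash equilibrium iff \<open>F xs \<bullet> (y - xs) \<ge> 0\<close> for all profiles \<open>y\<close>
(\<open>nash_equilibrium_iff_variational\<close>). A solution exists by Brouwer's theorem, applied to the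
projection of \<open>x - F x\<close>, and strong monotonicity makes it unique. Let \<open>e\<^sub>k\<close> be the difference between
the medians of means and \<open>F x\<^sub>k\<close>. Nonexpansiveness of the projections and strong monotonicity give
\<open>\<parallel>x\<^sub>k\<^sub>+\<^sub>1 - xs\<parallel>\<^sup>2 \<le> (1 - 2 \<mu> \<alpha>\<^sub>k) \<parallel>x\<^sub>k - xs\<parallel>\<^sup>2 + \<alpha>\<^sub>k \<eta>\<^sub>k\<close>, where \<open>\<eta>\<^sub>k \<longlonglongrightarrow> 0\<close> whenever \<open>e\<^sub>k \<longlonglongrightarrow> 0\<close>. As the step sizes
tend to \<open>0\<close> and have a divergent sum, the distances then tend to \<open>0\<close> along every such trajectory
(\<open>projected_gradient_converges\<close>).

It remains to see that \<open>e\<^sub>k \<longlonglongrightarrow> 0\<close> almost surely. Fix a tolerance \<open>t\<close>. Truncation turns the bound on the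
\<open>\<delta>\<close>-th moments into a weak law that is uniform in the distribution: the mean of a sufficiently large
block misses its target by more than \<open>t\<close> with probability at most \<open>1/4\<close>
(\<open>expectation_abs_mean_le\<close>). The median of \<open>n\<close> block means misses only if half of them do, which by
Hoeffding's inequality has probability at most \<open>exp (- n / 8)\<close> (\<open>median_of_means_deviation\<close>). These
estimates are for a fixed evaluation point. The iterate \<open>x\<^sub>k\<close> is random, but it is determined by the
past and the fresh samples are independent of the past, so that it may be frozen
(\<open>nn_integral_freeze\<close>, \<open>median_of_means_conditional_deviation\<close>). The block sizes tend to infinity, and
the block numbers are chosen such that \<open>exp (- n\<^sub>k / 8) \<le> 1 / (k + 1)\<^sup>2\<close> eventually. This is summable,
hence almost surely only finitely many medians miss by more than \<open>t\<close>.\<close>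

section \<open>Medians\<close>

lemma length_filter_take_le:
  "length (filter P (take j ys)) \<le> length (filter P ys)"
  by (metis append_take_drop_id filter_append le_add1 length_append)

lemma length_filter_sort: "length (filter P (sort xs)) = length (filter P xs)"
  by (metis mset_filter mset_sort size_mset)

text \<open>Counting replaces sorting: this form gives both the robustness of the median against outliers and
the measurability of order statistics.\<close>

lemma order_statistic_le_iff:
  fixes xs :: "'a::linorder list"
  assumes "j < length xs"
  shows "sort xs ! j \<le> t \<longleftrightarrow> j < length (filter (\<lambda>x. x \<le> t) xs)"
proof -
  let ?ys = "sort xs"
  show ?thesis
  proof
    assume le: "?ys ! j \<le> t"
    have "\<forall>x\<in>set (take (Suc j) ?ys). x \<le> t"
    proof
      fix x assume "x \<in> set (take (Suc j) ?ys)"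
      then obtain i where i: "i < length (take (Suc j) ?ys)" "x = take (Suc j) ?ys ! i"
        by (metis in_set_conv_nth)
      then have "x = ?ys ! i" "i \<le> j" by auto
      moreover have "?ys ! i \<le> ?ys ! j"
        using assms \<open>i \<le> j\<close> by (intro sorted_nth_mono) auto
      ultimately show "x \<le> t" using le by simp
    qed
    then have "length (filter (\<lambda>x. x \<le> t) (take (Suc j) ?ys)) = Suc j"
      using assms by simp
    then show "j < length (filter (\<lambda>x. x \<le> t) xs)"
      using length_filter_take_le[of "\<lambda>x. x \<le> t" "Suc j" ?ys] by (simp add: length_filter_sort)
  next
    assume less: "j < length (filter (\<lambda>x. x \<le> t) xs)"
    show "?ys ! j \<le> t"
    proof (rule ccontr)
      assume "\<not> ?ys ! j \<le> t"
      then have gt: "t < ?ys ! j" by simp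
      have "\<forall>x\<in>set (drop j ?ys). \<not> x \<le> t"
      proof
        fix x assume "x \<in> set (drop j ?ys)"
        then obtain i where i: "i < length (drop j ?ys)" "x = drop j ?ys ! i"
          by (metis in_set_conv_nth)
        then have "x = ?ys ! (j + i)" "j + i < length ?ys" using assms by auto
        moreover then have "?ys ! j \<le> ?ys ! (j + i)"
          by (intro sorted_nth_mono) auto
        ultimately show "\<not> x \<le> t" using gt by simp
      qed
      then have "filter (\<lambda>x. x \<le> t) (drop j ?ys) = []" by (simp add: filter_empty_conv)
      then have "filter (\<lambda>x. x \<le> t) ?ys = filter (\<lambda>x. x \<le> t) (take j ?ys)"
        by (metis append_Nil2 append_take_drop_id filter_append)
      then have "length (filter (\<lambda>x. x \<le> t) xs) \<le> j"
        by (metis length_filter_le length_filter_sort length_take min.bounded_iff)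
      with less show False by simp
    qed
  qed
qed

text \<open>If the lower of the two middle values were below \<open>lo\<close>, or the upper one above \<open>hi\<close>, then at
least half of the list would lie on that side; a minority of outliers cannot achieve this.\<close>

lemma median_in_interval:
  fixes xs :: "real list"
  assumes "2 * length (filter (\<lambda>x. x \<notin> {lo..hi}) xs) < length xs"
  shows "median xs \<in> {lo..hi}"
proof -
  let ?n = "length xs" and ?bad = "length (filter (\<lambda>x. x \<notin> {lo..hi}) xs)"
  have split: "length (filter P xs) + length (filter (\<lambda>x. \<not> P x) xs) = ?n" for P
    by (rule sum_length_filter_compl)
  have sub: "length (filter P xs) \<le> length (filter Q xs)" if "\<And>x. P x \<Longrightarrow> Q x" for P Q
    using that by (induction xs) auto
  have upper: "sort xs ! j \<le> hi" if "j < ?n" "2 * j \<le> ?n" for j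
  proof -
    have "length (filter (\<lambda>x. \<not> x \<le> hi) xs) \<le> ?bad" by (rule sub) auto
    then show ?thesis
      using that assms split[of "\<lambda>x. x \<le> hi"] by (simp add: order_statistic_le_iff)
  qed
  have lower: "lo \<le> sort xs ! j" if "j < ?n" "?n \<le> 2 * j + 2" for j
  proof (rule ccontr)
    assume "\<not> lo \<le> sort xs ! j"
    then have "j < length (filter (\<lambda>x. x \<le> sort xs ! j) xs)"
      using order_statistic_le_iff[OF that(1)] by blast
    also have "\<dots> \<le> ?bad" using \<open>\<not> lo \<le> sort xs ! j\<close> by (intro sub) auto
    finally show False using that assms by simp
  qed
  have n: "0 < ?n" using assms by linarith
  show ?thesis
  proof (cases "odd ?n")
    case True
    then obtain p where p: "?n = 2 * p + 1" by (auto elim: oddE)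
    show ?thesis
      using upper[of p] lower[of p] p by (simp add: median_def)
  next
    case False
    then obtain p where p: "?n = 2 * p" by (auto elim: evenE)
    have "p - 1 < ?n" "p < ?n" "2 * (p - 1) \<le> ?n" "?n \<le> 2 * (p - 1) + 2"
      using p n by auto
    then show ?thesis
      using upper[of "p - 1"] upper[of p] lower[of "p - 1"] lower[of p] p False
      by (simp add: median_def Let_def)
  qed
qed

lemma borel_measurable_median [measurable (raw)]:
  assumes [measurable]: "\<And>l. l < n \<Longrightarrow> g l \<in> borel_measurable M"
  shows "(\<lambda>\<omega>. median (map (\<lambda>l. g l \<omega>) [0..<n])) \<in> borel_measurable M"
proof -
  have order: "(\<lambda>\<omega>. sort (map (\<lambda>l. g l \<omega>) [0..<n]) ! j) \<in> borel_measurable M" if "j < n" for j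
    unfolding borel_measurable_iff_le
  proof
    fix t
    have "length (filter (\<lambda>x. x \<le> t) (map (\<lambda>l. g l \<omega>) [0..<n])) = (\<Sum>l<n. if g l \<omega> \<le> t then 1 else 0)" for \<omega>
      by (induction n) auto
    then have "{\<omega> \<in> space M. sort (map (\<lambda>l. g l \<omega>) [0..<n]) ! j \<le> t}
        = {\<omega> \<in> space M. j < (\<Sum>l<n. if g l \<omega> \<le> t then 1 else 0 :: nat)}"
      using that by (subst order_statistic_le_iff) auto
    also have "\<dots> \<in> sets M"
    proof -
      have "(\<lambda>\<omega>. if g l \<omega> \<le> t then 1 else 0 :: nat) \<in> measurable M (count_space UNIV)" if "l < n" for l
        using that by measurable
      then have "(\<lambda>\<omega>. \<Sum>l<n. if g l \<omega> \<le> t then 1 else 0 :: nat) \<in> measurable M (count_space UNIV)"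
        by (intro measurable_sum_nat) auto
      then show ?thesis by measurable
    qed
    finally show "{\<omega> \<in> space M. sort (map (\<lambda>l. g l \<omega>) [0..<n]) ! j \<le> t} \<in> sets M" .
  qed
  show ?thesis
  proof (cases "n = 0")
    case True
    then show ?thesis by simp
  next
    case False
    then show ?thesis
      using order[of "n div 2"] order[of "n div 2 - 1"]
      by (cases "odd n") (auto simp: median_def Let_def)
  qed
qed

section \<open>Concentration of the median of means\<close>

text \<open>The order of the choices matters: \<open>T\<close> is fixed first so that the tails are small, which uses
\<open>1 < \<delta>\<close>, and then the fluctuation of the truncated mean vanishes with growing \<open>s\<close>.\<close>

lemma truncation_level_exists:
  fixes V :: real
  assumes "1 < \<delta>" "0 < r"
  obtains T s\<^sub>0 where "0 < T" "0 < s\<^sub>0"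
    "\<And>s. s\<^sub>0 \<le> s \<Longrightarrow> 2 * T / sqrt (real s) + 2 * V * T powr (1 - \<delta>) \<le> r"
proof -
  have "((\<lambda>T. 2 * V * T powr (1 - \<delta>)) \<longlongrightarrow> 2 * V * 0) at_top"
    using \<open>1 < \<delta>\<close> by (intro tendsto_intros tendsto_neg_powr filterlim_ident) auto
  then have "eventually (\<lambda>T. 2 * V * T powr (1 - \<delta>) < r / 2) at_top"
    using assms by (intro order_tendstoD(2)[where a = "r / 2"]) auto
  then have "eventually (\<lambda>T. 2 * V * T powr (1 - \<delta>) < r / 2 \<and> 0 < T) at_top"
    using eventually_gt_at_top[of "0::real"] by eventually_elim auto
  then obtain T where T: "2 * V * T powr (1 - \<delta>) < r / 2" "0 < T"
    using eventually_happens by fastforce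
  have "((\<lambda>s. 2 * T / sqrt (real s)) \<longlongrightarrow> 0) sequentially"
    by (intro tendsto_divide_0[OF tendsto_const] filterlim_at_top_imp_at_infinity
      filterlim_compose[OF sqrt_at_top filterlim_real_sequentially])
  then have "eventually (\<lambda>s. 2 * T / sqrt (real s) < r / 2) sequentially"
    using assms by (intro order_tendstoD(2)[where a = "r / 2"]) auto
  then obtain s\<^sub>0 where s\<^sub>0: "\<And>s. s\<^sub>0 \<le> s \<Longrightarrow> 2 * T / sqrt (real s) < r / 2"
    by (auto simp: eventually_sequentially)
  show thesis
  proof (rule that[of T "Suc s\<^sub>0"])
    fix s assume "Suc s\<^sub>0 \<le> s"
    then show "2 * T / sqrt (real s) + 2 * V * T powr (1 - \<delta>) \<le> r"
      using s\<^sub>0[of s] T(1) by linarith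
  qed (use T(2) in auto)
qed

context prob_space begin

text \<open>The cross terms vanish by independence. Boundedness is assumed, as it holds for truncated
variables and settles all questions of integrability.\<close>

lemma second_moment_sum_le:
  fixes Y :: "'i \<Rightarrow> 'a \<Rightarrow> real"
  assumes "finite I" "indep_vars (\<lambda>_. borel) Y I"
    and "\<And>i \<omega>. i \<in> I \<Longrightarrow> \<bar>Y i \<omega>\<bar> \<le> C"
    and "\<And>i. i \<in> I \<Longrightarrow> expectation (Y i) = 0"
  shows "expectation (\<lambda>\<omega>. (\<Sum>i\<in>I. Y i \<omega>)\<^sup>2) \<le> real (card I) * C\<^sup>2"
  using assms
proof (induction I rule: finite_induct)
  case empty
  then show ?case by simp
next
  case (insert i I)
  define S where "S = (\<lambda>\<omega>. \<Sum>i\<in>I. Y i \<omega>)"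
  have indep: "indep_vars (\<lambda>_. borel) Y (insert i I)" by fact
  have meas: "Y j \<in> borel_measurable M" if "j \<in> insert i I" for j
    using indep that by (auto simp: indep_vars_def)
  have bound: "\<bar>Y j \<omega>\<bar> \<le> C" if "j \<in> insert i I" for j \<omega>
    using insert.prems(2) that by blast
  have C: "0 \<le> C" using bound[of i] abs_ge_zero order_trans by blast
  have [measurable]: "Y i \<in> borel_measurable M" using meas by simp
  have [measurable]: "S \<in> borel_measurable M"
    unfolding S_def using meas by (intro borel_measurable_sum) auto
  have Sbound: "\<bar>S \<omega>\<bar> \<le> real (card I) * C" for \<omega>
    unfolding S_def using sum_norm_bound[of I "\<lambda>j. Y j \<omega>" C] bound by auto
  have int_Y: "integrable M (Y i)"
    by (rule integrable_const_bound[where B = C]) (use bound in auto)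
  have int_S: "integrable M S"
    by (rule integrable_const_bound[where B = "real (card I) * C"]) (use Sbound in auto)
  have int_Y2: "integrable M (\<lambda>\<omega>. (Y i \<omega>)\<^sup>2)"
    by (rule integrable_const_bound[where B = "C\<^sup>2"])
      (use bound C in \<open>auto simp: abs_le_square_iff[symmetric] abs_mult\<close>)
  have int_S2: "integrable M (\<lambda>\<omega>. (S \<omega>)\<^sup>2)"
    by (rule integrable_const_bound[where B = "(real (card I) * C)\<^sup>2"])
      (use Sbound C in \<open>auto simp: abs_le_square_iff[symmetric] abs_mult\<close>)
  have ind: "indep_var borel (Y i) borel S"
    unfolding S_def by (rule indep_vars_sum) (use insert in auto)
  have int_YS: "integrable M (\<lambda>\<omega>. Y i \<omega> * S \<omega>)"
    by (rule indep_var_integrable[OF ind int_Y int_S])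
  have "expectation (\<lambda>\<omega>. Y i \<omega> * S \<omega>) = 0"
    using indep_var_lebesgue_integral[OF ind int_Y int_S] insert.prems(3)[of i] by simp
  then have "expectation (\<lambda>\<omega>. (Y i \<omega>)\<^sup>2 + 2 * (Y i \<omega> * S \<omega>) + (S \<omega>)\<^sup>2)
      = expectation (\<lambda>\<omega>. (Y i \<omega>)\<^sup>2) + expectation (\<lambda>\<omega>. (S \<omega>)\<^sup>2)"
    using int_Y2 int_YS int_S2 by simp
  moreover have "expectation (\<lambda>\<omega>. (Y i \<omega>)\<^sup>2) \<le> C\<^sup>2"
    using int_Y2 bound C by (intro integral_le_const) (auto simp: abs_le_square_iff[symmetric] abs_mult)
  moreover have "expectation (\<lambda>\<omega>. (S \<omega>)\<^sup>2) \<le> real (card I) * C\<^sup>2"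
    unfolding S_def
  proof (rule insert.IH)
    show "indep_vars (\<lambda>_. borel) Y I"
      using indep by (rule indep_vars_subset) auto
  qed (use insert.prems in auto)
  moreover have "(\<Sum>j\<in>insert i I. Y j \<omega>)\<^sup>2 = (Y i \<omega>)\<^sup>2 + 2 * (Y i \<omega> * S \<omega>) + (S \<omega>)\<^sup>2" for \<omega>
    using insert.hyps by (simp add: S_def power2_sum)
  ultimately show ?case
    using insert.hyps by (simp add: algebra_simps)
qed

text \<open>With \<open>\<delta> < 2\<close> the variance may be infinite, so the variables are truncated at level \<open>T\<close>. The
truncated parts, once centred, are bounded by \<open>2 T\<close>, so that the mean of \<open>card I\<close> of them has root
mean square at most \<open>2 T / sqrt (card I)\<close>; the tails have
first moment at most \<open>V T\<^sup>1\<^sup>-\<^sup>\<delta>\<close>, which is counted twice because cutting them off also shifts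
the expectation.\<close>

lemma expectation_abs_mean_le:
  fixes Y :: "'i \<Rightarrow> 'a \<Rightarrow> real"
  assumes "finite I" "I \<noteq> {}"
    and indep: "indep_vars (\<lambda>_. borel) Y I"
    and int: "\<And>i. i \<in> I \<Longrightarrow> integrable M (Y i)"
    and mean: "\<And>i. i \<in> I \<Longrightarrow> expectation (Y i) = 0"
    and int_powr: "\<And>i. i \<in> I \<Longrightarrow> integrable M (\<lambda>\<omega>. \<bar>Y i \<omega>\<bar> powr \<delta>)"
    and moment: "\<And>i. i \<in> I \<Longrightarrow> expectation (\<lambda>\<omega>. \<bar>Y i \<omega>\<bar> powr \<delta>) \<le> V"
    and "1 < \<delta>" "0 < T"
  shows "expectation (\<lambda>\<omega>. \<bar>(\<Sum>i\<in>I. Y i \<omega>) / real (card I)\<bar>)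
      \<le> 2 * T / sqrt (real (card I)) + 2 * V * T powr (1 - \<delta>)"
proof -
  define low where "low = (\<lambda>y::real. if \<bar>y\<bar> \<le> T then y else 0)"
  define Z where "Z = (\<lambda>i \<omega>. low (Y i \<omega>) - expectation (\<lambda>\<omega>. low (Y i \<omega>)))"
  define R where "R = (\<lambda>i \<omega>. Y i \<omega> - low (Y i \<omega>))"
  define q where "q = real (card I)"
  have q: "0 < q" using assms(1,2) by (simp add: q_def card_gt_0_iff)
  have [measurable]: "low \<in> borel_measurable borel" unfolding low_def by measurable
  have meas [measurable]: "Y i \<in> borel_measurable M" if "i \<in> I" for i using int[OF that] by auto
  have low_bound: "\<bar>low y\<bar> \<le> T" for y using \<open>0 < T\<close> by (simp add: low_def)
  have int_low: "integrable M (\<lambda>\<omega>. low (Y i \<omega>))" if "i \<in> I" for i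
    by (rule integrable_const_bound[where B = T]) (use low_bound that in auto)
  have int_R: "integrable M (R i)" if "i \<in> I" for i
    unfolding R_def using int[OF that] int_low[OF that] by simp
  have tail: "\<bar>y - low y\<bar> \<le> \<bar>y\<bar> powr \<delta> * T powr (1 - \<delta>)" for y
  proof (cases "\<bar>y\<bar> \<le> T")
    case False
    then have "\<bar>y\<bar> = \<bar>y\<bar> powr \<delta> * \<bar>y\<bar> powr (1 - \<delta>)"
      using \<open>0 < T\<close> by (simp add: powr_add[symmetric])
    also have "\<dots> \<le> \<bar>y\<bar> powr \<delta> * T powr (1 - \<delta>)"
      using False \<open>0 < T\<close> \<open>1 < \<delta>\<close> by (intro mult_left_mono powr_mono2') auto
    finally show ?thesis using False by (simp add: low_def)
  qed (simp add: low_def)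
  have E_R: "expectation (\<lambda>\<omega>. \<bar>R i \<omega>\<bar>) \<le> V * T powr (1 - \<delta>)" if "i \<in> I" for i
  proof -
    have "expectation (\<lambda>\<omega>. \<bar>R i \<omega>\<bar>) \<le> expectation (\<lambda>\<omega>. \<bar>Y i \<omega>\<bar> powr \<delta> * T powr (1 - \<delta>))"
      using int_R[OF that] int_powr[OF that] tail by (intro integral_mono) (auto simp: R_def)
    also have "\<dots> \<le> V * T powr (1 - \<delta>)"
      using moment[OF that] by (simp add: mult_right_mono)
    finally show ?thesis .
  qed
  have E_low: "\<bar>expectation (\<lambda>\<omega>. low (Y i \<omega>))\<bar> \<le> V * T powr (1 - \<delta>)" if "i \<in> I" for i
  proof -
    have "expectation (\<lambda>\<omega>. low (Y i \<omega>)) = - expectation (R i)"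
      using int[OF that] int_low[OF that] mean[OF that] by (simp add: R_def)
    then have "\<bar>expectation (\<lambda>\<omega>. low (Y i \<omega>))\<bar> \<le> expectation (\<lambda>\<omega>. \<bar>R i \<omega>\<bar>)"
      by simp
    also note E_R[OF that]
    finally show ?thesis .
  qed
  have Z_bound: "\<bar>Z i \<omega>\<bar> \<le> 2 * T" if "i \<in> I" for i \<omega>
  proof -
    have "\<bar>expectation (\<lambda>\<omega>. low (Y i \<omega>))\<bar> \<le> expectation (\<lambda>\<omega>. \<bar>low (Y i \<omega>)\<bar>)"
      by simp
    also have "\<dots> \<le> T"
      using int_low[OF that] low_bound by (intro integral_le_const) auto
    finally show ?thesis unfolding Z_def using low_bound[of "Y i \<omega>"] by linarith
  qed
  have Z_meas [measurable]: "Z i \<in> borel_measurable M" if "i \<in> I" for i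
    unfolding Z_def using that by measurable
  have Z_sum_bound: "\<bar>\<Sum>i\<in>I. Z i \<omega>\<bar> \<le> q * (2 * T)" for \<omega>
    unfolding q_def using sum_norm_bound[of I "\<lambda>i. Z i \<omega>" "2 * T"] Z_bound by auto
  have int_Z: "integrable M (\<lambda>\<omega>. \<Sum>i\<in>I. Z i \<omega>)"
    by (rule integrable_const_bound[where B = "q * (2 * T)"]) (use Z_sum_bound in auto)
  have int_Z2: "integrable M (\<lambda>\<omega>. (\<Sum>i\<in>I. Z i \<omega>)\<^sup>2)"
    by (rule integrable_const_bound[where B = "(q * (2 * T))\<^sup>2"])
      (use Z_sum_bound q \<open>0 < T\<close> in \<open>auto simp: abs_le_square_iff[symmetric] abs_mult\<close>)
  have second: "expectation (\<lambda>\<omega>. (\<Sum>i\<in>I. Z i \<omega>)\<^sup>2) \<le> q * (2 * T)\<^sup>2"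
    unfolding q_def
  proof (rule second_moment_sum_le)
    show "indep_vars (\<lambda>_. borel) Z I"
      unfolding Z_def by (rule indep_vars_compose2[OF indep]) auto
    show "expectation (Z i) = 0" if "i \<in> I" for i
      unfolding Z_def using int_low[OF that] by (simp add: prob_space)
  qed (use assms Z_bound in auto)
  define r where "r = 2 * T * sqrt q"
  have r: "0 < r" "r\<^sup>2 = q * (2 * T)\<^sup>2"
    using q \<open>0 < T\<close> by (auto simp: r_def power_mult_distrib)
  have Z_abs: "expectation (\<lambda>\<omega>. \<bar>\<Sum>i\<in>I. Z i \<omega>\<bar>) \<le> r"
  proof -
    \<comment> \<open>A quadratic majorant of the absolute value, tangent to it at the root mean square \<open>r\<close>.\<close>
    have "\<bar>x\<bar> \<le> x\<^sup>2 / (2 * r) + r / 2" for x :: real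
    proof -
      have "0 \<le> (\<bar>x\<bar> - r)\<^sup>2" by simp
      then show ?thesis using r by (simp add: power2_diff field_simps power2_eq_square)
    qed
    then have "expectation (\<lambda>\<omega>. \<bar>\<Sum>i\<in>I. Z i \<omega>\<bar>)
        \<le> expectation (\<lambda>\<omega>. (\<Sum>i\<in>I. Z i \<omega>)\<^sup>2 / (2 * r) + r / 2)"
      using int_Z int_Z2 by (intro integral_mono) auto
    also have "\<dots> = expectation (\<lambda>\<omega>. (\<Sum>i\<in>I. Z i \<omega>)\<^sup>2) / (2 * r) + r / 2"
      using int_Z2 by (simp add: prob_space)
    also have "\<dots> \<le> r\<^sup>2 / (2 * r) + r / 2"
      using second r by (intro add_right_mono divide_right_mono) auto
    also have "\<dots> = r" using r(1) by (simp add: power2_eq_square)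
    finally show ?thesis .
  qed
  \<comment> \<open>\<open>Y i\<close> is the centred truncation \<open>Z i\<close>, plus the tail \<open>R i\<close>, plus the shift of the expectation.\<close>
  have "\<bar>\<Sum>i\<in>I. Y i \<omega>\<bar> \<le> \<bar>\<Sum>i\<in>I. Z i \<omega>\<bar> + (\<Sum>i\<in>I. \<bar>R i \<omega>\<bar>) + q * (V * T powr (1 - \<delta>))" for \<omega>
  proof -
    have "(\<Sum>i\<in>I. Y i \<omega>) = (\<Sum>i\<in>I. Z i \<omega>) + (\<Sum>i\<in>I. R i \<omega>)
        + (\<Sum>i\<in>I. expectation (\<lambda>\<omega>. low (Y i \<omega>)))"
      by (simp add: Z_def R_def sum_subtractf)
    moreover have "\<bar>\<Sum>i\<in>I. R i \<omega>\<bar> \<le> (\<Sum>i\<in>I. \<bar>R i \<omega>\<bar>)" by (rule sum_abs)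
    moreover have "\<bar>\<Sum>i\<in>I. expectation (\<lambda>\<omega>. low (Y i \<omega>))\<bar> \<le> q * (V * T powr (1 - \<delta>))"
      unfolding q_def
      using sum_norm_bound[of I "\<lambda>i. expectation (\<lambda>\<omega>. low (Y i \<omega>))" "V * T powr (1 - \<delta>)"] E_low
      by auto
    ultimately show ?thesis by linarith
  qed
  then have "expectation (\<lambda>\<omega>. \<bar>\<Sum>i\<in>I. Y i \<omega>\<bar>)
      \<le> expectation (\<lambda>\<omega>. \<bar>\<Sum>i\<in>I. Z i \<omega>\<bar> + (\<Sum>i\<in>I. \<bar>R i \<omega>\<bar>) + q * (V * T powr (1 - \<delta>)))"
    using int int_Z int_R by (intro integral_mono) auto
  also have "\<dots> = expectation (\<lambda>\<omega>. \<bar>\<Sum>i\<in>I. Z i \<omega>\<bar>) + (\<Sum>i\<in>I. expectation (\<lambda>\<omega>. \<bar>R i \<omega>\<bar>))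
      + q * (V * T powr (1 - \<delta>))"
    using int_Z int_R by (simp add: prob_space)
  also have "\<dots> \<le> r + q * (V * T powr (1 - \<delta>)) + q * (V * T powr (1 - \<delta>))"
    unfolding q_def using Z_abs E_R by (intro add_mono sum_bounded_above) auto
  finally have "expectation (\<lambda>\<omega>. \<bar>\<Sum>i\<in>I. Y i \<omega>\<bar>) \<le> r + 2 * q * V * T powr (1 - \<delta>)"
    by (simp add: mult_ac)
  then have "expectation (\<lambda>\<omega>. \<bar>\<Sum>i\<in>I. Y i \<omega>\<bar>) / q \<le> (r + 2 * q * V * T powr (1 - \<delta>)) / q"
    using q by (intro divide_right_mono) auto
  also have "\<dots> = 2 * T / sqrt q + 2 * V * T powr (1 - \<delta>)"
    using q by (simp add: r_def field_simps real_div_sqrt)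
  finally show ?thesis using q by (simp add: q_def abs_divide)
qed

lemma prob_abs_mean_ge_le:
  fixes Y :: "'i \<Rightarrow> 'a \<Rightarrow> real"
  assumes "finite I" "I \<noteq> {}"
    and indep: "indep_vars (\<lambda>_. borel) Y I"
    and int: "\<And>i. i \<in> I \<Longrightarrow> integrable M (Y i)"
    and mean: "\<And>i. i \<in> I \<Longrightarrow> expectation (Y i) = 0"
    and int_powr: "\<And>i. i \<in> I \<Longrightarrow> integrable M (\<lambda>\<omega>. \<bar>Y i \<omega>\<bar> powr \<delta>)"
    and moment: "\<And>i. i \<in> I \<Longrightarrow> expectation (\<lambda>\<omega>. \<bar>Y i \<omega>\<bar> powr \<delta>) \<le> V"
    and "1 < \<delta>" "0 < T" "0 < t"
  shows "prob {\<omega> \<in> space M. t \<le> \<bar>(\<Sum>i\<in>I. Y i \<omega>) / real (card I)\<bar>}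
      \<le> (2 * T / sqrt (real (card I)) + 2 * V * T powr (1 - \<delta>)) / t"
proof -
  have "prob {\<omega> \<in> space M. t \<le> \<bar>(\<Sum>i\<in>I. Y i \<omega>) / real (card I)\<bar>}
      \<le> expectation (\<lambda>\<omega>. \<bar>(\<Sum>i\<in>I. Y i \<omega>) / real (card I)\<bar>) / t"
    using int \<open>0 < t\<close> by (intro integral_Markov_inequality_measure[where A = "{}"]) auto
  also have "\<dots> \<le> (2 * T / sqrt (real (card I)) + 2 * V * T powr (1 - \<delta>)) / t"
    using expectation_abs_mean_le[OF assms(1-9)] \<open>0 < t\<close> by (intro divide_right_mono) auto
  finally show ?thesis .
qed

text \<open>The median can leave an interval only if at least half of the block means do. These events are
independent with probability at most \<open>1/4\<close> each, so their number exceeds its expectation by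
at least \<open>n/4\<close>, and Hoeffding's inequality for \<open>n\<close> indicators gives \<open>exp (- 2 (n/4)\<^sup>2 / n)\<close>.\<close>

lemma median_of_means_deviation:
  assumes blocks: "valid_blocks m n s B" and "0 < n"
    and indep: "indep_vars (\<lambda>_. borel) Y {..<m}"
    and block: "\<And>l. l < n \<Longrightarrow>
      prob {\<omega> \<in> space M. (\<Sum>j\<in>B l. Y j \<omega>) / real s \<notin> {lo..hi}} \<le> 1 / 4"
  shows "prob {\<omega> \<in> space M. median_of_means n s B (\<lambda>j. Y j \<omega>) \<notin> {lo..hi}} \<le> exp (- real n / 8)"
proof -
  define bad where
    "bad = (\<lambda>l \<omega>. if (\<Sum>j\<in>B l. Y j \<omega>) / real s \<in> {lo..hi} then 0 else 1 :: real)"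
  have B: "B l \<subseteq> {..<m}" if "l < n" for l
    using blocks that by (auto simp: valid_blocks_def)
  have [measurable]: "Y j \<in> borel_measurable M" if "j < m" for j
    using indep that by (auto simp: indep_vars_def)
  have Y_meas: "(\<lambda>\<omega>. \<Sum>j\<in>B l. Y j \<omega>) \<in> borel_measurable M" if "l < n" for l
    using B[OF that] by (intro borel_measurable_sum) auto
  have bad_meas [measurable]: "bad l \<in> borel_measurable M" if "l < n" for l
    using Y_meas[OF that] unfolding bad_def by measurable
  have bad_indep: "indep_vars (\<lambda>_. borel) bad {..<n}"
  proof -
    have "indep_vars (\<lambda>_. borel)
        (\<lambda>l \<omega>. (\<lambda>y. if (\<Sum>j\<in>B l. y j) / real s \<in> {lo..hi} then 0 else 1 :: real)
                 (restrict (\<lambda>j. Y j \<omega>) (B l))) {..<n}"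
    proof (rule indep_vars_compose2[OF indep_vars_restrict[OF indep]])
      show "disjoint_family_on B {..<n}" using blocks by (simp add: valid_blocks_def)
      show "(\<lambda>y. if (\<Sum>j\<in>B l. y j) / real s \<in> {lo..hi} then 0 else 1 :: real)
          \<in> borel_measurable (Pi\<^sub>M (B l) (\<lambda>_. borel))" for l
      proof -
        have "(\<lambda>y. \<Sum>j\<in>B l. y j) \<in> borel_measurable (Pi\<^sub>M (B l) (\<lambda>_. borel :: real measure))"
          by (intro borel_measurable_sum measurable_component_singleton)
        then show ?thesis by measurable
      qed
    qed (use B in auto)
    then show ?thesis unfolding bad_def by simp
  qed
  interpret bad: Hoeffding_ineq M "{..<n}" bad "\<lambda>_. 0" "\<lambda>_. 1" "\<Sum>l<n. expectation (bad l)"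
    by unfold_locales (use bad_indep in \<open>auto simp: bad_def\<close>)
  have "expectation (bad l) \<le> 1 / 4" if "l < n" for l
  proof -
    have "expectation (bad l)
        = expectation (indicator {\<omega> \<in> space M. (\<Sum>j\<in>B l. Y j \<omega>) / real s \<notin> {lo..hi}})"
      by (intro Bochner_Integration.integral_cong) (auto simp: bad_def indicator_def)
    also have "\<dots> = prob {\<omega> \<in> space M. (\<Sum>j\<in>B l. Y j \<omega>) / real s \<notin> {lo..hi}}"
      by (simp add: Int_def conj_commute)
    finally show ?thesis using block[OF that] by simp
  qed
  then have mean: "(\<Sum>l<n. expectation (bad l)) \<le> real n / 4"
    using sum_bounded_above[of "{..<n}" "\<lambda>l. expectation (bad l)" "1 / 4"] by simp
  have "real n / 2 \<le> (\<Sum>l<n. bad l \<omega>)"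
    if "median_of_means n s B (\<lambda>j. Y j \<omega>) \<notin> {lo..hi}" for \<omega>
  proof -
    let ?xs = "map (\<lambda>l. (\<Sum>j\<in>B l. Y j \<omega>) / real s) [0..<n]"
    have "real (length (filter (\<lambda>x. x \<notin> {lo..hi}) ?xs)) = (\<Sum>l<n. bad l \<omega>)"
      by (induction n) (auto simp: bad_def)
    moreover have "\<not> 2 * length (filter (\<lambda>x. x \<notin> {lo..hi}) ?xs) < n"
      using median_in_interval[where xs = ?xs and lo = lo and hi = hi] that
      unfolding median_of_means_def length_map length_upt by (metis diff_zero)
    ultimately show ?thesis by linarith
  qed
  then have "prob {\<omega> \<in> space M. median_of_means n s B (\<lambda>j. Y j \<omega>) \<notin> {lo..hi}}
      \<le> prob {\<omega> \<in> space M. (\<Sum>l<n. expectation (bad l)) + real n / 4 \<le> (\<Sum>l<n. bad l \<omega>)}"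
  proof (intro finite_measure_mono)
    show "{\<omega> \<in> space M. (\<Sum>l<n. expectation (bad l)) + real n / 4 \<le> (\<Sum>l<n. bad l \<omega>)} \<in> events"
      by measurable
  qed (use mean in force)
  also have "\<dots> \<le> exp (- 2 * (real n / 4)\<^sup>2 / (\<Sum>l<n. (1 - 0)\<^sup>2))"
    by (rule bad.Hoeffding_ineq_ge) (use \<open>0 < n\<close> in auto)
  also have "- 2 * (real n / 4)\<^sup>2 / (\<Sum>l<n. (1 - 0)\<^sup>2) = - real n / 8"
    using \<open>0 < n\<close> by (simp add: power2_eq_square)
  finally show ?thesis .
qed

end

lemma borel_measurable_median_of_means:
  assumes "valid_blocks m n s B" "\<And>j. j < m \<Longrightarrow> g j \<in> borel_measurable N"
  shows "(\<lambda>\<omega>. median_of_means n s B (\<lambda>j. g j \<omega>)) \<in> borel_measurable N"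
proof -
  have "(\<lambda>\<omega>. \<Sum>j\<in>B l. g j \<omega>) \<in> borel_measurable N" if "l < n" for l
    using assms that by (intro borel_measurable_sum) (auto simp: valid_blocks_def)
  then show ?thesis
    unfolding median_of_means_def by (intro borel_measurable_median) auto
qed

lemma median_of_means_cong:
  assumes "valid_blocks m n s B" "\<And>j. j < m \<Longrightarrow> g j = g' j"
  shows "median_of_means n s B g = median_of_means n s B g'"
proof -
  have "(\<Sum>j\<in>B l. g j) = (\<Sum>j\<in>B l. g' j)" if "l < n" for l
    using assms that by (intro sum.cong) (auto simp: valid_blocks_def)
  then show ?thesis
    unfolding median_of_means_def by (intro arg_cong[where f = median] map_cong) auto
qed

section \<open>Freezing the past\<close>

context prob_space begin

text \<open>When \<open>Z\<close> is independent of \<open>F\<close>, the pair of the identity, viewed as a map into \<open>F\<close>, and \<open>Z\<close>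
has a product law. By Fubini the \<open>F\<close>-measurable argument may then be held fixed while \<open>Z\<close> is
integrated out over an independent copy \<open>\<omega>'\<close>.\<close>

lemma nn_integral_freeze:
  assumes sub: "subalgebra M F" and Z: "Z \<in> measurable M N"
    and indep: "indep_set (sets F) {Z -` A \<inter> space M |A. A \<in> sets N}"
    and phi: "\<phi> \<in> borel_measurable (F \<Otimes>\<^sub>M N)"
  shows "(\<integral>\<^sup>+\<omega>. \<phi> (\<omega>, Z \<omega>) \<partial>M) = (\<integral>\<^sup>+\<omega>. \<integral>\<^sup>+\<omega>'. \<phi> (\<omega>, Z \<omega>') \<partial>M \<partial>M)"
proof -
  have id: "(\<lambda>\<omega>. \<omega>) \<in> measurable M F"
    using sub by (auto simp: subalgebra_def measurable_def intro: sets.sets_into_space)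
  interpret F: prob_space "distr M F (\<lambda>\<omega>. \<omega>)" using id by (rule prob_space_distr)
  interpret Z: prob_space "distr M N Z" using Z by (rule prob_space_distr)
  have joint: "distr M F (\<lambda>\<omega>. \<omega>) \<Otimes>\<^sub>M distr M N Z = distr M (F \<Otimes>\<^sub>M N) (\<lambda>\<omega>. (\<omega>, Z \<omega>))"
  proof (rule pair_measure_eqI)
    fix A C assume "A \<in> sets (distr M F (\<lambda>\<omega>. \<omega>))" "C \<in> sets (distr M N Z)"
    then have A: "A \<in> sets F" and C: "C \<in> sets N" by auto
    have "A \<subseteq> space M"
      using sets.sets_into_space[OF A] sub by (simp add: subalgebra_def)
    then have "(\<lambda>\<omega>. (\<omega>, Z \<omega>)) -` (A \<times> C) \<inter> space M = A \<inter> (Z -` C \<inter> space M)"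
      "(\<lambda>\<omega>. \<omega>) -` A \<inter> space M = A" by auto
    moreover have "prob (A \<inter> (Z -` C \<inter> space M)) = prob A * prob (Z -` C \<inter> space M)"
      using indep A C by (intro indep_setD) auto
    ultimately show "emeasure (distr M F (\<lambda>\<omega>. \<omega>)) A * emeasure (distr M N Z) C
        = emeasure (distr M (F \<Otimes>\<^sub>M N) (\<lambda>\<omega>. (\<omega>, Z \<omega>))) (A \<times> C)"
      using A C id Z by (simp add: emeasure_distr emeasure_eq_measure ennreal_mult)
  qed (auto intro: F.sigma_finite_measure_axioms Z.sigma_finite_measure_axioms)
  have "(\<integral>\<^sup>+\<omega>. \<phi> (\<omega>, Z \<omega>) \<partial>M) = (\<integral>\<^sup>+p. \<phi> p \<partial>distr M (F \<Otimes>\<^sub>M N) (\<lambda>\<omega>. (\<omega>, Z \<omega>)))"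
    using id Z phi by (subst nn_integral_distr) auto
  also have "\<dots> = (\<integral>\<^sup>+\<omega>. \<integral>\<^sup>+z. \<phi> (\<omega>, z) \<partial>distr M N Z \<partial>distr M F (\<lambda>\<omega>. \<omega>))"
    using phi by (subst joint[symmetric], subst Z.nn_integral_fst)
      (auto cong: measurable_cong_sets sets_pair_measure_cong)
  also have "\<dots> = (\<integral>\<^sup>+\<omega>. \<integral>\<^sup>+z. \<phi> (\<omega>, z) \<partial>distr M N Z \<partial>M)"
  proof (rule nn_integral_distr[OF id])
    show "(\<lambda>\<omega>. \<integral>\<^sup>+z. \<phi> (\<omega>, z) \<partial>distr M N Z) \<in> borel_measurable (distr M F (\<lambda>\<omega>. \<omega>))"
      using phi by (intro Z.borel_measurable_nn_integral)
        (auto cong: measurable_cong_sets sets_pair_measure_cong)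
  qed
  also have "\<dots> = (\<integral>\<^sup>+\<omega>. \<integral>\<^sup>+\<omega>'. \<phi> (\<omega>, Z \<omega>') \<partial>M \<partial>M)"
  proof (rule nn_integral_cong)
    fix \<omega> assume "\<omega> \<in> space M"
    then have "\<omega> \<in> space F" using sub by (simp add: subalgebra_def)
    then show "(\<integral>\<^sup>+z. \<phi> (\<omega>, z) \<partial>distr M N Z) = (\<integral>\<^sup>+\<omega>'. \<phi> (\<omega>, Z \<omega>') \<partial>M)"
      using phi Z by (subst nn_integral_distr) auto
  qed
  finally show ?thesis .
qed

text \<open>Restricting \<open>\<phi>\<close> to an event of \<open>F\<close> changes only its first argument, so the previous lemma applies on
every such event, which characterises the conditional expectation.\<close>

lemma nn_cond_exp_freeze:
  assumes sub: "subalgebra M F" and Z: "Z \<in> measurable M N"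
    and indep: "indep_set (sets F) {Z -` A \<inter> space M |A. A \<in> sets N}"
    and phi: "\<phi> \<in> borel_measurable (F \<Otimes>\<^sub>M N)"
  shows "AE \<omega> in M. nn_cond_exp M F (\<lambda>\<omega>. \<phi> (\<omega>, Z \<omega>)) \<omega> = (\<integral>\<^sup>+\<omega>'. \<phi> (\<omega>, Z \<omega>') \<partial>M)"
proof -
  interpret finite_measure_subalgebra M F
    using sub by unfold_locales
  interpret Z: prob_space "distr M N Z" using Z by (rule prob_space_distr)
  have "AE \<omega> in M. (\<integral>\<^sup>+\<omega>'. \<phi> (\<omega>, Z \<omega>') \<partial>M) = nn_cond_exp M F (\<lambda>\<omega>. \<phi> (\<omega>, Z \<omega>)) \<omega>"
  proof (rule nn_cond_exp_charact)
    fix A assume A [measurable]: "A \<in> sets F"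
    have "(\<lambda>p. \<phi> p * indicator A (fst p)) \<in> borel_measurable (F \<Otimes>\<^sub>M N)"
      using phi by measurable
    from nn_integral_freeze[OF sub Z indep this]
    have "(\<integral>\<^sup>+\<omega>\<in>A. \<phi> (\<omega>, Z \<omega>) \<partial>M) = (\<integral>\<^sup>+\<omega>. \<integral>\<^sup>+\<omega>'. \<phi> (\<omega>, Z \<omega>') * indicator A \<omega> \<partial>M \<partial>M)"
      by simp
    also have "\<dots> = (\<integral>\<^sup>+\<omega>\<in>A. (\<integral>\<^sup>+\<omega>'. \<phi> (\<omega>, Z \<omega>') \<partial>M) \<partial>M)"
      by (intro nn_integral_cong) (auto simp: indicator_def)
    finally show "(\<integral>\<^sup>+\<omega>\<in>A. \<phi> (\<omega>, Z \<omega>) \<partial>M) = (\<integral>\<^sup>+\<omega>\<in>A. (\<integral>\<^sup>+\<omega>'. \<phi> (\<omega>, Z \<omega>') \<partial>M) \<partial>M)" .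
  next
    have "(\<lambda>\<omega>. (\<omega>, Z \<omega>)) \<in> measurable M (F \<Otimes>\<^sub>M N)"
      using sub Z by (intro measurable_Pair) (auto simp: subalgebra_def measurable_def intro: sets.sets_into_space)
    then show "(\<lambda>\<omega>. \<phi> (\<omega>, Z \<omega>)) \<in> borel_measurable M"
      using phi by (rule measurable_compose)
  next
    have "(\<lambda>\<omega>. \<integral>\<^sup>+z. \<phi> (\<omega>, z) \<partial>distr M N Z) \<in> borel_measurable F"
      using phi by (intro Z.borel_measurable_nn_integral)
        (auto cong: measurable_cong_sets sets_pair_measure_cong)
    moreover have "(\<integral>\<^sup>+z. \<phi> (\<omega>, z) \<partial>distr M N Z) = (\<integral>\<^sup>+\<omega>'. \<phi> (\<omega>, Z \<omega>') \<partial>M)" if "\<omega> \<in> space F" for \<omega>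
      using phi Z that by (subst nn_integral_distr) auto
    ultimately show "(\<lambda>\<omega>. \<integral>\<^sup>+\<omega>'. \<phi> (\<omega>, Z \<omega>') \<partial>M) \<in> borel_measurable F"
      by (simp cong: measurable_cong)
  qed
  then show ?thesis by eventually_elim simp
qed

text \<open>Conditional hypotheses on the noise become plain ones: for almost every past \<open>\<omega>\<close>, the noise with
the past frozen at \<open>\<omega>\<close> is centred and has the same moment bound. The conditional expectation of a
real function is the difference of those of its positive and negative parts, and both parts can be
frozen separately.\<close>

lemma frozen_noise_moments:
  assumes sub: "subalgebra M F" and Z: "Z \<in> measurable M N"
    and indep: "indep_set (sets F) {Z -` A \<inter> space M |A. A \<in> sets N}"
    and h: "h \<in> borel_measurable (F \<Otimes>\<^sub>M N)"
    and mean: "AE \<omega> in M. real_cond_exp M F (\<lambda>\<omega>. h (\<omega>, Z \<omega>)) \<omega> = 0"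
    and moment: "AE \<omega> in M. nn_cond_exp M F (\<lambda>\<omega>. ennreal (\<bar>h (\<omega>, Z \<omega>)\<bar> powr \<delta>)) \<omega> \<le> ennreal V"
    and "1 < \<delta>" "0 \<le> V"
  shows "AE \<omega> in M. integrable M (\<lambda>\<omega>'. h (\<omega>, Z \<omega>')) \<and> expectation (\<lambda>\<omega>'. h (\<omega>, Z \<omega>')) = 0 \<and>
      integrable M (\<lambda>\<omega>'. \<bar>h (\<omega>, Z \<omega>')\<bar> powr \<delta>) \<and> expectation (\<lambda>\<omega>'. \<bar>h (\<omega>, Z \<omega>')\<bar> powr \<delta>) \<le> V"
proof -
  note freeze = nn_cond_exp_freeze[OF sub Z indep]
  have "AE \<omega> in M. nn_cond_exp M F (\<lambda>\<omega>. ennreal (\<bar>h (\<omega>, Z \<omega>)\<bar> powr \<delta>)) \<omega>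
      = (\<integral>\<^sup>+\<omega>'. ennreal (\<bar>h (\<omega>, Z \<omega>')\<bar> powr \<delta>) \<partial>M)"
    using h by (intro freeze[where \<phi> = "\<lambda>p. ennreal (\<bar>h p\<bar> powr \<delta>)"]) measurable
  moreover have "AE \<omega> in M. nn_cond_exp M F (\<lambda>\<omega>. ennreal (h (\<omega>, Z \<omega>))) \<omega>
      = (\<integral>\<^sup>+\<omega>'. ennreal (h (\<omega>, Z \<omega>')) \<partial>M)"
    using h by (intro freeze[where \<phi> = "\<lambda>p. ennreal (h p)"]) measurable
  moreover have "AE \<omega> in M. nn_cond_exp M F (\<lambda>\<omega>. ennreal (- h (\<omega>, Z \<omega>))) \<omega>
      = (\<integral>\<^sup>+\<omega>'. ennreal (- h (\<omega>, Z \<omega>')) \<partial>M)"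
    using h by (intro freeze[where \<phi> = "\<lambda>p. ennreal (- h p)"]) measurable
  ultimately show ?thesis
    using mean moment AE_space
  proof eventually_elim
    case (elim \<omega>)
    define Y where "Y = (\<lambda>\<omega>'. h (\<omega>, Z \<omega>'))"
    have "\<omega> \<in> space F" using elim(6) sub by (simp add: subalgebra_def)
    then have [measurable]: "Y \<in> borel_measurable M"
      unfolding Y_def using h Z by measurable
    have le: "(\<integral>\<^sup>+\<omega>'. ennreal (\<bar>Y \<omega>'\<bar> powr \<delta>) \<partial>M) \<le> ennreal V"
      using elim by (simp add: Y_def)
    have int_powr: "integrable M (\<lambda>\<omega>'. \<bar>Y \<omega>'\<bar> powr \<delta>)"
      using le by (intro integrableI_bounded) (auto simp: le_less_trans)
    then have E: "expectation (\<lambda>\<omega>'. \<bar>Y \<omega>'\<bar> powr \<delta>) \<le> V"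
      using le \<open>0 \<le> V\<close> by (simp add: nn_integral_eq_integral)
    \<comment> \<open>The moment of order \<open>\<delta>\<close> provides the integrability without which the mean would be a default value.\<close>
    have "\<bar>y\<bar> \<le> 1 + \<bar>y\<bar> powr \<delta>" for y :: real
    proof (cases "\<bar>y\<bar> \<le> 1")
      case False
      then have "\<bar>y\<bar> powr 1 \<le> \<bar>y\<bar> powr \<delta>" using \<open>1 < \<delta>\<close> by (intro powr_mono) auto
      then show ?thesis using False by simp
    qed (use powr_ge_zero[of "\<bar>y\<bar>" \<delta>] in linarith)
    then have int: "integrable M Y"
      by (intro Bochner_Integration.integrable_bound[OF Bochner_Integration.integrable_add[OF
            integrable_const[of 1] int_powr]]) auto
    have "expectation Y = 0"
      using elim int by (simp add: Y_def real_lebesgue_integral_def real_cond_exp_def)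
    then show ?case using int int_powr E by (simp add: Y_def)
  qed
qed

end

lemma space_generated_by [simp]: "space (generated_by M X I) = space M"
  unfolding generated_by_def by (rule space_measure_of) auto

lemma measurable_generated_by:
  assumes "p \<in> I"
  shows "X p \<in> borel_measurable (generated_by M X I)"
proof (rule measurableI)
  fix A :: "real set" assume "A \<in> sets borel"
  then have "X p -` A \<inter> space M \<in> {X p -` A \<inter> space M |p A. p \<in> I \<and> A \<in> sets borel}"
    using assms by blast
  then show "X p -` A \<inter> space (generated_by M X I) \<in> sets (generated_by M X I)"
    unfolding generated_by_def by (subst sets_measure_of) (auto simp: space_measure_of_conv)
qed simp

lemma sets_generated_by_subset:
  assumes "space N = space M" "\<And>p. p \<in> I \<Longrightarrow> X p \<in> borel_measurable N"
  shows "sets (generated_by M X I) \<subseteq> sets N"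
proof -
  have "{X p -` A \<inter> space M |p A. p \<in> I \<and> A \<in> sets borel} \<subseteq> sets N"
    using assms by (auto simp flip: assms(1) intro: measurable_sets)
  then have "sigma_sets (space M) {X p -` A \<inter> space M |p A. p \<in> I \<and> A \<in> sets borel} \<subseteq> sets N"
    unfolding assms(1)[symmetric] by (rule sets.sigma_sets_subset)
  then show ?thesis
    unfolding generated_by_def by (subst sets_measure_of) auto
qed

lemma (in prob_space) indep_set_preimages:
  assumes "indep_set \<A> (sets G)" "space G = space M" "Z \<in> measurable G N"
  shows "indep_set \<A> {Z -` A \<inter> space M |A. A \<in> sets N}"
proof -
  have "Z -` A \<inter> space M \<in> sets G" if "A \<in> sets N" for A
    using measurable_sets[OF assms(3) that] assms(2) by simp
  then show ?thesis
    using assms(1) unfolding indep_set_def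
    by (elim indep_sets_mono_sets) (auto split: bool.split)
qed

context prob_space begin

text \<open>The evaluation point \<open>\<omega>\<close> of \<open>g\<close> and \<open>c\<close> is determined by the past \<open>F\<close>, of which the samples are
independent. For almost every frozen past the block means obey the truncated weak law, so the bound
\<open>exp (- n / 8)\<close> holds for the frozen median of means; integrating over the past gives it for the
actual one. The accuracy condition makes each block fail with probability at most \<open>1/4\<close>.\<close>

lemma median_of_means_conditional_deviation:
  fixes \<zeta> :: "nat \<Rightarrow> 'a \<Rightarrow> real" and g :: "'a \<Rightarrow> real \<Rightarrow> real"
  assumes "1 < \<delta>" "0 < t" "0 \<le> V" "0 < T" and s: "0 < s" and n: "0 < n"
    and accuracy: "2 * T / sqrt (real s) + 2 * V * T powr (1 - \<delta>) \<le> t / 4"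
    and blocks: "valid_blocks m n s B"
    and sub: "subalgebra M F" and \<zeta>: "\<And>j. j < m \<Longrightarrow> \<zeta> j \<in> borel_measurable M"
    and indep: "indep_vars (\<lambda>_. borel) \<zeta> {..<m}"
    and fresh: "indep_set (sets F) (sets (generated_by M \<zeta> {..<m}))"
    and g: "(\<lambda>(\<omega>, z). g \<omega> z) \<in> borel_measurable (F \<Otimes>\<^sub>M borel)"
    and c: "c \<in> borel_measurable F"
    and mean: "\<And>j. j < m \<Longrightarrow> AE \<omega> in M. real_cond_exp M F (\<lambda>\<omega>. g \<omega> (\<zeta> j \<omega>) - c \<omega>) \<omega> = 0"
    and moment: "\<And>j. j < m \<Longrightarrow> AE \<omega> in M.
       nn_cond_exp M F (\<lambda>\<omega>. ennreal (\<bar>g \<omega> (\<zeta> j \<omega>) - c \<omega>\<bar> powr \<delta>)) \<omega> \<le> ennreal V"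
  shows "{\<omega> \<in> space M. median_of_means n s B (\<lambda>j. g \<omega> (\<zeta> j \<omega>)) \<notin> {c \<omega> - t..c \<omega> + t}} \<in> events"
      (is "?bad \<in> events")
    and "prob {\<omega> \<in> space M. median_of_means n s B (\<lambda>j. g \<omega> (\<zeta> j \<omega>)) \<notin> {c \<omega> - t..c \<omega> + t}}
      \<le> exp (- real n / 8)"
proof -
  let ?N = "Pi\<^sub>M {..<m} (\<lambda>_. borel :: real measure)"
  define Z where "Z = (\<lambda>\<omega>. \<lambda>j\<in>{..<m}. \<zeta> j \<omega>)"
  define \<psi> where "\<psi> = (\<lambda>(\<omega>, z). median_of_means n s B (\<lambda>j. g \<omega> (z j)) - c \<omega>)"
  define \<phi> where "\<phi> = (\<lambda>p. if \<psi> p \<in> {-t..t} then 0 else 1 :: ennreal)"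
  have Z_meas: "Z \<in> measurable M ?N" "Z \<in> measurable (generated_by M \<zeta> {..<m}) ?N"
    unfolding Z_def using \<zeta> by (auto intro!: measurable_restrict measurable_generated_by)
  have Z_indep: "indep_set (sets F) {Z -` A \<inter> space M |A. A \<in> sets ?N}"
    by (rule indep_set_preimages[OF fresh _ Z_meas(2)]) simp
  have "(\<lambda>p. g (fst p) (snd p j)) \<in> borel_measurable (F \<Otimes>\<^sub>M ?N)" if "j < m" for j
  proof -
    have "(\<lambda>p. (fst p, snd p j)) \<in> measurable (F \<Otimes>\<^sub>M ?N) (F \<Otimes>\<^sub>M borel)"
      using that by (intro measurable_Pair measurable_fst
        measurable_compose[OF measurable_snd measurable_component_singleton]) simp
    from measurable_compose[OF this g] show ?thesis by simp
  qed
  from borel_measurable_median_of_means[OF blocks this]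
  have "\<psi> \<in> borel_measurable (F \<Otimes>\<^sub>M ?N)"
    unfolding \<psi>_def split_beta using c by measurable
  then have \<phi>: "\<phi> \<in> borel_measurable (F \<Otimes>\<^sub>M ?N)"
    unfolding \<phi>_def by measurable
  have \<psi>_Z: "\<psi> (\<omega>, Z \<omega>') = median_of_means n s B (\<lambda>j. g \<omega> (\<zeta> j \<omega>')) - c \<omega>" for \<omega> \<omega>'
    unfolding \<psi>_def split_conv Z_def
    by (intro arg_cong2[where f = "(-)"] median_of_means_cong[OF blocks]) auto
  \<comment> \<open>From here on \<open>\<omega>\<close> fixes the past and \<open>\<omega>'\<close> ranges over the fresh samples.\<close>
  have frozen: "AE \<omega> in M. \<forall>j<m. integrable M (\<lambda>\<omega>'. g \<omega> (\<zeta> j \<omega>') - c \<omega>) \<and>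
      expectation (\<lambda>\<omega>'. g \<omega> (\<zeta> j \<omega>') - c \<omega>) = 0 \<and>
      integrable M (\<lambda>\<omega>'. \<bar>g \<omega> (\<zeta> j \<omega>') - c \<omega>\<bar> powr \<delta>) \<and>
      expectation (\<lambda>\<omega>'. \<bar>g \<omega> (\<zeta> j \<omega>') - c \<omega>\<bar> powr \<delta>) \<le> V"
  proof -
    have "AE \<omega> in M. integrable M (\<lambda>\<omega>'. g \<omega> (\<zeta> j \<omega>') - c \<omega>) \<and>
        expectation (\<lambda>\<omega>'. g \<omega> (\<zeta> j \<omega>') - c \<omega>) = 0 \<and>
        integrable M (\<lambda>\<omega>'. \<bar>g \<omega> (\<zeta> j \<omega>') - c \<omega>\<bar> powr \<delta>) \<and>
        expectation (\<lambda>\<omega>'. \<bar>g \<omega> (\<zeta> j \<omega>') - c \<omega>\<bar> powr \<delta>) \<le> V" if "j < m" for j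
    proof -
      have "(\<lambda>p. g (fst p) (snd p) - c (fst p)) \<in> borel_measurable (F \<Otimes>\<^sub>M borel)"
        using g c unfolding split_beta by measurable
      moreover have "indep_set (sets F) {\<zeta> j -` A \<inter> space M |A. A \<in> sets borel}"
        using that by (intro indep_set_preimages[OF fresh _ measurable_generated_by]) auto
      ultimately show ?thesis
        using frozen_noise_moments[OF sub \<zeta>[OF that], of "\<lambda>p. g (fst p) (snd p) - c (fst p)" \<delta> V]
          mean[OF that] moment[OF that] \<open>1 < \<delta>\<close> \<open>0 \<le> V\<close> by simp
    qed
    then have "AE \<omega> in M. \<forall>j\<in>{..<m}. integrable M (\<lambda>\<omega>'. g \<omega> (\<zeta> j \<omega>') - c \<omega>) \<and>
        expectation (\<lambda>\<omega>'. g \<omega> (\<zeta> j \<omega>') - c \<omega>) = 0 \<and>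
        integrable M (\<lambda>\<omega>'. \<bar>g \<omega> (\<zeta> j \<omega>') - c \<omega>\<bar> powr \<delta>) \<and>
        expectation (\<lambda>\<omega>'. \<bar>g \<omega> (\<zeta> j \<omega>') - c \<omega>\<bar> powr \<delta>) \<le> V"
      by (intro AE_finite_allI) auto
    then show ?thesis by eventually_elim auto
  qed
  have "AE \<omega> in M. (\<integral>\<^sup>+\<omega>'. \<phi> (\<omega>, Z \<omega>') \<partial>M) \<le> ennreal (exp (- real n / 8))"
    using frozen AE_space
  proof eventually_elim
    case (elim \<omega>)
    have "\<omega> \<in> space F" using elim(2) sub by (simp add: subalgebra_def)
    then have g_meas [measurable]: "g \<omega> \<in> borel_measurable borel"
      using measurable_compose[OF measurable_Pair1'[of \<omega> F borel] g] by simp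
    have g_indep: "indep_vars (\<lambda>_. borel) (\<lambda>j \<omega>'. g \<omega> (\<zeta> j \<omega>')) {..<m}"
      by (rule indep_vars_compose2[OF indep]) simp
    have "prob {\<omega>' \<in> space M. median_of_means n s B (\<lambda>j. g \<omega> (\<zeta> j \<omega>')) \<notin> {c \<omega> - t..c \<omega> + t}}
        \<le> exp (- real n / 8)"
    proof (rule median_of_means_deviation[OF blocks n g_indep])
      fix l assume "l < n"
      then have B: "B l \<subseteq> {..<m}" "card (B l) = s"
        using blocks by (auto simp: valid_blocks_def)
      have fin: "finite (B l)" using B(1) finite_subset by blast
      let ?Y = "\<lambda>j \<omega>'. g \<omega> (\<zeta> j \<omega>') - c \<omega>"
      have "indep_vars (\<lambda>_. borel) (\<lambda>j \<omega>'. (\<lambda>y. y - c \<omega>) (g \<omega> (\<zeta> j \<omega>'))) (B l)"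
        by (rule indep_vars_compose2[OF indep_vars_subset[OF g_indep B(1)]]) simp
      moreover have "B l \<noteq> {}" using B(2) s by auto
      ultimately have "prob {\<omega>' \<in> space M. t \<le> \<bar>(\<Sum>j\<in>B l. ?Y j \<omega>') / real s\<bar>}
          \<le> (2 * T / sqrt (real s) + 2 * V * T powr (1 - \<delta>)) / t"
        using prob_abs_mean_ge_le[of "B l" ?Y \<delta> V T t] fin B elim(1) \<open>1 < \<delta>\<close> \<open>0 < T\<close> \<open>0 < t\<close>
        by (auto simp: subset_iff)
      also have "\<dots> \<le> 1 / 4"
        using accuracy \<open>0 < t\<close> by (simp add: field_simps)
      finally have "prob {\<omega>' \<in> space M. t \<le> \<bar>(\<Sum>j\<in>B l. ?Y j \<omega>') / real s\<bar>} \<le> 1 / 4" .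
      moreover have "prob {\<omega>' \<in> space M. (\<Sum>j\<in>B l. g \<omega> (\<zeta> j \<omega>')) / real s \<notin> {c \<omega> - t..c \<omega> + t}}
          \<le> prob {\<omega>' \<in> space M. t \<le> \<bar>(\<Sum>j\<in>B l. ?Y j \<omega>') / real s\<bar>}"
      proof (rule finite_measure_mono)
        have "(\<Sum>j\<in>B l. ?Y j \<omega>') / real s = (\<Sum>j\<in>B l. g \<omega> (\<zeta> j \<omega>')) / real s - c \<omega>" for \<omega>'
          using B(2) s by (simp add: sum_subtractf diff_divide_distrib)
        then show "{\<omega>' \<in> space M. (\<Sum>j\<in>B l. g \<omega> (\<zeta> j \<omega>')) / real s \<notin> {c \<omega> - t..c \<omega> + t}}
            \<subseteq> {\<omega>' \<in> space M. t \<le> \<bar>(\<Sum>j\<in>B l. ?Y j \<omega>') / real s\<bar>}" by auto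
        have "(\<lambda>\<omega>'. \<Sum>j\<in>B l. ?Y j \<omega>') \<in> borel_measurable M"
          using B(1) \<zeta> by (intro borel_measurable_sum) auto
        then show "{\<omega>' \<in> space M. t \<le> \<bar>(\<Sum>j\<in>B l. ?Y j \<omega>') / real s\<bar>} \<in> events" by measurable
      qed
      ultimately show "prob {\<omega>' \<in> space M. (\<Sum>j\<in>B l. g \<omega> (\<zeta> j \<omega>')) / real s \<notin> {c \<omega> - t..c \<omega> + t}}
          \<le> 1 / 4" by linarith
    qed
    moreover have "(\<integral>\<^sup>+\<omega>'. \<phi> (\<omega>, Z \<omega>') \<partial>M)
        = emeasure M {\<omega>' \<in> space M. median_of_means n s B (\<lambda>j. g \<omega> (\<zeta> j \<omega>')) \<notin> {c \<omega> - t..c \<omega> + t}}"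
    proof -
      have "(\<lambda>\<omega>'. median_of_means n s B (\<lambda>j. g \<omega> (\<zeta> j \<omega>'))) \<in> borel_measurable M"
        using \<zeta> by (intro borel_measurable_median_of_means[OF blocks]) auto
      then have "{\<omega>' \<in> space M. median_of_means n s B (\<lambda>j. g \<omega> (\<zeta> j \<omega>')) \<notin> {c \<omega> - t..c \<omega> + t}} \<in> events"
        by measurable
      moreover have "(\<integral>\<^sup>+\<omega>'. \<phi> (\<omega>, Z \<omega>') \<partial>M) = (\<integral>\<^sup>+\<omega>'. indicator {\<omega>' \<in> space M.
          median_of_means n s B (\<lambda>j. g \<omega> (\<zeta> j \<omega>')) \<notin> {c \<omega> - t..c \<omega> + t}} \<omega>' \<partial>M)"
        by (intro nn_integral_cong) (auto simp: \<phi>_def \<psi>_Z indicator_def)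
      ultimately show ?thesis by simp
    qed
    ultimately show ?case by (simp add: emeasure_eq_measure)
  qed
  then have "(\<integral>\<^sup>+\<omega>. \<integral>\<^sup>+\<omega>'. \<phi> (\<omega>, Z \<omega>') \<partial>M \<partial>M) \<le> (\<integral>\<^sup>+\<omega>. ennreal (exp (- real n / 8)) \<partial>M)"
    by (rule nn_integral_mono_AE)
  then have le: "(\<integral>\<^sup>+\<omega>. \<phi> (\<omega>, Z \<omega>) \<partial>M) \<le> ennreal (exp (- real n / 8))"
    by (simp add: nn_integral_freeze[OF sub Z_meas(1) Z_indep \<phi>] emeasure_space_1)
  have "(\<lambda>\<omega>. (\<omega>, Z \<omega>)) \<in> measurable M (F \<Otimes>\<^sub>M ?N)"
    using sub Z_meas(1) by (intro measurable_Pair measurable_from_subalg[OF sub measurable_ident_sets]) auto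
  from measurable_compose[OF this \<open>\<psi> \<in> borel_measurable (F \<Otimes>\<^sub>M ?N)\<close>]
  have "(\<lambda>\<omega>. \<psi> (\<omega>, Z \<omega>)) \<in> borel_measurable M" .
  then have "{\<omega> \<in> space M. \<psi> (\<omega>, Z \<omega>) \<notin> {-t..t}} \<in> events" by measurable
  moreover have bad: "?bad = {\<omega> \<in> space M. \<psi> (\<omega>, Z \<omega>) \<notin> {-t..t}}"
    by (auto simp: \<psi>_Z)
  ultimately have events: "?bad \<in> events" by simp
  have "emeasure M ?bad = (\<integral>\<^sup>+\<omega>. indicator ?bad \<omega> \<partial>M)"
    using events by simp
  also have "\<dots> = (\<integral>\<^sup>+\<omega>. \<phi> (\<omega>, Z \<omega>) \<partial>M)"
    unfolding bad by (intro nn_integral_cong) (auto simp: \<phi>_def indicator_def)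
  finally have "ennreal (prob ?bad) \<le> ennreal (exp (- real n / 8))"
    using le by (simp only: emeasure_eq_measure)
  then have "prob ?bad \<le> exp (- real n / 8)"
    by (subst (asm) ennreal_le_iff) auto
  with events show "?bad \<in> events" "prob ?bad \<le> exp (- real n / 8)" by simp_all
qed

end

section \<open>Nash equilibria as solutions of a variational inequality\<close>

lemma deviate_eq_add_axis: "deviate x i t = x + (t - x $ i) *\<^sub>R axis i 1"
  by (simp add: deviate_def vec_eq_iff axis_def)

lemma deviate_self [simp]: "deviate x i (x $ i) = x"
  by (simp add: deviate_eq_add_axis)

lemma inner_deviate_diff: "v \<bullet> (deviate x i t - x) = v $ i * (t - x $ i)"
  by (simp add: deviate_eq_add_axis inner_axis)

lemma deviate_in_action_profiles:
  "x \<in> action_profiles \<Omega> \<Longrightarrow> t \<in> \<Omega> i \<Longrightarrow> deviate x i t \<in> action_profiles \<Omega>"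
  by (simp add: action_profiles_def deviate_def)

lemma action_set_eq_image:
  assumes "action_profiles \<Omega> \<noteq> {}"
  shows "\<Omega> i = (\<lambda>x. x $ i) ` action_profiles \<Omega>"
proof -
  obtain y where y: "y \<in> action_profiles \<Omega>" using assms by blast
  show ?thesis
  proof safe
    fix t assume "t \<in> \<Omega> i"
    then have "deviate y i t \<in> action_profiles \<Omega>" "deviate y i t $ i = t"
      using y by (auto simp: action_profiles_def deviate_def)
    then show "t \<in> (\<lambda>x. x $ i) ` action_profiles \<Omega>" by force
  qed (simp add: action_profiles_def)
qed

lemma action_set_convex_compact:
  fixes \<Omega> :: "'n::finite \<Rightarrow> real set"
  assumes "action_profiles \<Omega> \<noteq> {}" "convex (action_profiles \<Omega>)" "compact (action_profiles \<Omega>)"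
  shows "\<Omega> i \<noteq> {}" "convex (\<Omega> i)" "compact (\<Omega> i)"
proof -
  have lin: "linear (\<lambda>x :: real^'n. x $ i)" by (simp add: linear_iff)
  show "\<Omega> i \<noteq> {}" "convex (\<Omega> i)" "compact (\<Omega> i)"
    using assms
    by (simp_all add: action_set_eq_image[OF assms(1), of i] convex_linear_image[OF lin]
        compact_continuous_image continuous_on_component continuous_on_id)
qed

lemma has_partial_deriv:
  assumes "GDERIV h x :> G"
  shows "((\<lambda>t. h (deviate x i t)) has_real_derivative partial_deriv h i x) (at (x $ i))"
proof -
  have "((\<lambda>t. x + (t - x $ i) *\<^sub>R axis i 1) has_derivative (\<lambda>s. s *\<^sub>R axis i 1)) (at (x $ i))"
    by (auto intro!: derivative_eq_intros)
  moreover have "(h has_derivative (\<lambda>v. G \<bullet> v)) (at (x + (x $ i - x $ i) *\<^sub>R axis i 1))"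
    using assms by (simp add: gderiv_def inner_commute)
  ultimately have "((\<lambda>t. h (deviate x i t)) has_derivative (\<lambda>s. G \<bullet> (s *\<^sub>R axis i 1))) (at (x $ i))"
    unfolding deviate_eq_add_axis by (rule has_derivative_compose)
  then have "((\<lambda>t. h (deviate x i t)) has_real_derivative (G \<bullet> axis i 1)) (at (x $ i))"
    by (simp add: has_field_derivative_def mult_commute_abs)
  then show ?thesis
    unfolding partial_deriv_def by (simp add: DERIV_imp_deriv)
qed

text \<open>Compare \<open>\<phi>\<close> along the segment from \<open>u\<close> to \<open>t\<close>. A negative slope at \<open>u\<close> would give a smaller value
nearby, and a smaller value at \<open>t\<close> would, by convexity, force a negative slope at \<open>u\<close>. Only the
derivative at \<open>u\<close> enters, so \<open>u\<close> may be an end point of \<open>S\<close>.\<close>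

lemma convex_minimum_iff_variational:
  fixes \<phi> :: "real \<Rightarrow> real"
  assumes "convex_on S \<phi>" "u \<in> S" "(\<phi> has_real_derivative D) (at u)"
  shows "(\<forall>t\<in>S. \<phi> u \<le> \<phi> t) \<longleftrightarrow> (\<forall>t\<in>S. 0 \<le> D * (t - u))"
proof -
  have along: "((\<lambda>h. \<phi> (u + h * (t - u))) has_real_derivative D * (t - u)) (at 0)" for t
  proof -
    have "((\<lambda>h. u + h * (t - u)) has_real_derivative (t - u)) (at 0)"
      by (auto intro!: derivative_eq_intros)
    from DERIV_chain2[where f = \<phi>, OF _ this] assms(3) show ?thesis by simp
  qed
  have "0 \<le> D * (t - u)" if min: "\<forall>t\<in>S. \<phi> u \<le> \<phi> t" and "t \<in> S" for t
  proof (rule ccontr)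
    assume "\<not> 0 \<le> D * (t - u)"
    with DERIV_neg_dec_right[OF along[of t]] obtain d
      where d: "0 < d" "\<And>h. 0 < h \<Longrightarrow> h < d \<Longrightarrow> \<phi> (u + h * (t - u)) < \<phi> u"
      by auto
    define h where "h = min (d / 2) 1"
    have h: "0 < h" "h < d" "h \<le> 1" using d(1) by (auto simp: h_def)
    have "u + h * (t - u) \<in> S"
      using convexD_alt[OF convex_on_imp_convex[OF assms(1)] assms(2) \<open>t \<in> S\<close>, of h] h
      by (simp add: algebra_simps)
    then show False using min d(2)[OF h(1,2)] by fastforce
  qed
  moreover have "\<phi> u \<le> \<phi> t" if nonneg: "0 \<le> D * (t - u)" and "t \<in> S" for t
  proof (rule ccontr)
    assume less: "\<not> \<phi> u \<le> \<phi> t"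
    have "((\<lambda>h. \<phi> (u + h * (t - u)) - h * (\<phi> t - \<phi> u)) has_real_derivative
        D * (t - u) - (\<phi> t - \<phi> u)) (at 0)"
      using along[of t] by (auto intro!: derivative_eq_intros)
    from DERIV_pos_inc_right[OF this] obtain d where d: "0 < d"
      "\<And>h. 0 < h \<Longrightarrow> h < d \<Longrightarrow> \<phi> u < \<phi> (u + h * (t - u)) - h * (\<phi> t - \<phi> u)"
      using nonneg less by auto
    define h where "h = min (d / 2) 1"
    have h: "0 < h" "h < d" "h \<le> 1" using d(1) by (auto simp: h_def)
    have "\<phi> (u + h * (t - u)) \<le> (1 - h) * \<phi> u + h * \<phi> t"
      using convex_onD[OF assms(1), of h u t] assms(2) \<open>t \<in> S\<close> h by (simp add: algebra_simps)
    then show False using d(2)[OF h(1,2)] by (simp add: algebra_simps)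
  qed
  ultimately show ?thesis by blast
qed

text \<open>Each player's optimality is a scalar variational inequality. Since the profiles form a product set,
the inequalities of all players add up to the one for the pseudo-gradient, and unilateral deviations
give them back.\<close>

lemma nash_equilibrium_iff_variational:
  assumes deriv: "\<And>i x. x \<in> action_profiles \<Omega> \<Longrightarrow>
      ((\<lambda>t. J i (deviate x i t)) has_real_derivative pseudo_gradient J x $ i) (at (x $ i))"
    and convex: "\<And>i x. x \<in> action_profiles \<Omega> \<Longrightarrow> convex_on (\<Omega> i) (\<lambda>t. J i (deviate x i t))"
  shows "nash_equilibrium \<Omega> J x \<longleftrightarrow>
    x \<in> action_profiles \<Omega> \<and> (\<forall>y\<in>action_profiles \<Omega>. 0 \<le> pseudo_gradient J x \<bullet> (y - x))"
proof (cases "x \<in> action_profiles \<Omega>")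
  case True
  have "nash_equilibrium \<Omega> J x \<longleftrightarrow> (\<forall>i. \<forall>t\<in>\<Omega> i. 0 \<le> pseudo_gradient J x $ i * (t - x $ i))"
    using True convex_minimum_iff_variational[OF convex _ deriv, OF True _ True]
    by (simp add: nash_equilibrium_def action_profiles_def)
  also have "\<dots> \<longleftrightarrow> (\<forall>y\<in>action_profiles \<Omega>. 0 \<le> pseudo_gradient J x \<bullet> (y - x))"
  proof safe
    fix y assume "\<forall>i. \<forall>t\<in>\<Omega> i. 0 \<le> pseudo_gradient J x $ i * (t - x $ i)" "y \<in> action_profiles \<Omega>"
    then show "0 \<le> pseudo_gradient J x \<bullet> (y - x)"
      by (auto simp: inner_vec_def action_profiles_def intro!: sum_nonneg)
  next
    fix i t assume "\<forall>y\<in>action_profiles \<Omega>. 0 \<le> pseudo_gradient J x \<bullet> (y - x)" "t \<in> \<Omega> i"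
    then show "0 \<le> pseudo_gradient J x $ i * (t - x $ i)"
      using deviate_in_action_profiles[OF True] inner_deviate_diff by metis
  qed
  finally show ?thesis using True by simp
qed (simp add: nash_equilibrium_def)

text \<open>A fixed point of \<open>x \<mapsto> closest_point S (x - F x)\<close>, which Brouwer's theorem provides, is a solution: the
obtuse angle property of the projection at \<open>x - F x\<close> is the variational inequality.\<close>

lemma variational_solution_exists:
  fixes F :: "'a::euclidean_space \<Rightarrow> 'a"
  assumes "S \<noteq> {}" "convex S" "compact S" "continuous_on S F"
  shows "\<exists>x\<in>S. \<forall>y\<in>S. 0 \<le> F x \<bullet> (y - x)"
proof -
  have S: "closed S" using assms(3) by (rule compact_imp_closed)
  have "continuous_on S (\<lambda>x. closest_point S (x - F x))"
    by (rule continuous_on_compose2[OF continuous_on_closest_point[OF assms(2) S assms(1), of UNIV]])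
      (auto intro!: continuous_intros assms)
  moreover have "(\<lambda>x. closest_point S (x - F x)) \<in> S \<rightarrow> S"
    using closest_point_in_set[OF S assms(1)] by auto
  ultimately obtain x where x: "x \<in> S" "closest_point S (x - F x) = x"
    using brouwer[OF assms(3,2,1)] by blast
  have "0 \<le> F x \<bullet> (y - x)" if "y \<in> S" for y
    using closest_point_dot[OF assms(2) S that, of "x - F x"] x(2) by simp
  then show ?thesis using x(1) by blast
qed

lemma variational_solution_unique:
  assumes "0 < \<mu>" "strongly_monotone_on \<mu> S F" "x \<in> S" "y \<in> S"
    and "0 \<le> F x \<bullet> (y - x)" "0 \<le> F y \<bullet> (x - y)"
  shows "x = y"
proof -
  have "\<mu> * (norm (x - y))\<^sup>2 \<le> (F x - F y) \<bullet> (x - y)"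
    using assms by (simp add: strongly_monotone_on_def)
  also have "\<dots> = - (F x \<bullet> (y - x)) - F y \<bullet> (x - y)"
    by (simp add: inner_diff_left inner_diff_right)
  also have "\<dots> \<le> 0" using assms by simp
  finally show ?thesis using assms(1) by (simp add: mult_le_0_iff)
qed

section \<open>Inexact projected gradient steps\<close>

text \<open>Once \<open>\<eta> k < c e / 2\<close> and \<open>c \<alpha> k < 1\<close>, the excess of \<open>d\<close> over \<open>e / 2\<close> is multiplied by at most \<open>1 - c \<alpha> k\<close>, hence by
at most \<open>exp (- c \<alpha> k)\<close>, in each step. The divergent sum of the \<open>\<alpha> k\<close> drives it to \<open>0\<close>.\<close>

lemma vanishing_recursion:
  fixes d \<alpha> \<eta> :: "nat \<Rightarrow> real"
  assumes nonneg: "\<And>k. 0 \<le> d k"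
    and "0 < c" and \<alpha>: "\<And>k. 0 \<le> \<alpha> k" and small: "\<alpha> \<longlonglongrightarrow> 0"
    and diverges: "filterlim (\<lambda>n. \<Sum>k<n. \<alpha> k) at_top sequentially"
    and \<eta>: "\<eta> \<longlonglongrightarrow> 0"
    and step: "eventually (\<lambda>k. d (Suc k) \<le> (1 - c * \<alpha> k) * d k + \<alpha> k * \<eta> k) sequentially"
  shows "d \<longlonglongrightarrow> 0"
proof -
  have "eventually (\<lambda>k. d k < e) sequentially" if "0 < e" for e
  proof -
    have "eventually (\<lambda>k. \<alpha> k < 1 / c) sequentially"
      using small \<open>0 < c\<close> by (intro order_tendstoD(2)) auto
    moreover have "eventually (\<lambda>k. \<eta> k < c * (e / 2)) sequentially"
      using \<eta> \<open>0 < c\<close> \<open>0 < e\<close> by (intro order_tendstoD(2)) auto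
    ultimately have "eventually (\<lambda>k. \<alpha> k < 1 / c \<and> \<eta> k < c * (e / 2) \<and>
        d (Suc k) \<le> (1 - c * \<alpha> k) * d k + \<alpha> k * \<eta> k) sequentially"
      using step by eventually_elim simp
    then obtain K where K: "\<And>k. K \<le> k \<Longrightarrow> \<alpha> k < 1 / c" "\<And>k. K \<le> k \<Longrightarrow> \<eta> k < c * (e / 2)"
      "\<And>k. K \<le> k \<Longrightarrow> d (Suc k) \<le> (1 - c * \<alpha> k) * d k + \<alpha> k * \<eta> k"
      unfolding eventually_sequentially by blast
    define A where "A = (\<lambda>n. \<Sum>k<n. \<alpha> k)"
    \<comment> \<open>The bound on \<open>\<alpha>\<close> keeps the factor nonnegative, so that the estimate can be iterated.\<close>
    have decay: "d k - e / 2 \<le> exp (- c * (A k - A K)) * d K" if "K \<le> k" for k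
      using that
    proof (induction rule: dec_induct)
      case base
      then show ?case using \<open>0 < e\<close> by simp
    next
      case (step k)
      have nn: "0 \<le> 1 - c * \<alpha> k" using K(1)[OF step(1)] \<open>0 < c\<close> by (simp add: field_simps)
      have "d (Suc k) - e / 2 \<le> (1 - c * \<alpha> k) * d k + \<alpha> k * (c * (e / 2)) - e / 2"
        using K(2,3)[OF step(1)] mult_left_mono[of "\<eta> k" "c * (e / 2)" "\<alpha> k"] \<alpha>[of k] by linarith
      also have "\<dots> = (1 - c * \<alpha> k) * (d k - e / 2)" by (simp add: algebra_simps)
      also have "\<dots> \<le> (1 - c * \<alpha> k) * (exp (- c * (A k - A K)) * d K)"
        using step.IH nn by (rule mult_left_mono)
      also have "\<dots> \<le> exp (- (c * \<alpha> k)) * (exp (- c * (A k - A K)) * d K)"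
        using nonneg exp_ge_add_one_self[of "- (c * \<alpha> k)"] by (intro mult_right_mono) auto
      also have "\<dots> = exp (- c * (A (Suc k) - A K)) * d K"
        by (simp add: A_def mult.assoc[symmetric] exp_add[symmetric] algebra_simps)
      finally show ?case .
    qed
    have "((\<lambda>k. exp (- c * (A k - A K)) * d K) \<longlongrightarrow> 0 * d K) sequentially"
    proof (intro tendsto_mult tendsto_const filterlim_compose[OF exp_at_bot])
      have "filterlim (\<lambda>k. - A K + A k) at_top sequentially"
        by (rule filterlim_tendsto_add_at_top[OF tendsto_const]) (use diverges in \<open>simp add: A_def\<close>)
      then have "filterlim (\<lambda>k. c * (A k - A K)) at_top sequentially"
        using \<open>0 < c\<close> by (intro filterlim_tendsto_pos_mult_at_top[OF tendsto_const]) auto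
      then show "filterlim (\<lambda>k. - c * (A k - A K)) at_bot sequentially"
        by (simp add: filterlim_uminus_at_top)
    qed
    then have "eventually (\<lambda>k. exp (- c * (A k - A K)) * d K < e / 2) sequentially"
      using \<open>0 < e\<close> by (intro order_tendstoD(2)) auto
    then show ?thesis
      using eventually_ge_at_top[of K] by eventually_elim (use decay in force)
  qed
  then show ?thesis
    using nonneg by (intro order_tendstoI) (auto intro: eventuallyI less_le_trans)
qed

text \<open>The projections act coordinatewise, are nonexpansive and fix \<open>xs\<close>. Expanding the square, strong
monotonicity together with the variational inequality at \<open>xs\<close> yields the contraction, and the
gradient error \<open>g - F x\<close> enters only through the term that is multiplied by \<open>\<alpha>\<close>.\<close>

lemma projected_gradient_step_le:
  fixes x xs g :: "real^'n"
  assumes \<Omega>: "\<And>i. convex (\<Omega> i)" "\<And>i. closed (\<Omega> i)"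
    and mono: "strongly_monotone_on \<mu> (action_profiles \<Omega>) F"
    and x: "x \<in> action_profiles \<Omega>" and xs: "xs \<in> action_profiles \<Omega>"
    and solution: "0 \<le> F xs \<bullet> (x - xs)"
    and bounds: "norm (x - xs) \<le> D" "norm (F x) \<le> G" and "0 \<le> \<alpha>"
  shows "(norm ((\<chi> i. closest_point (\<Omega> i) (x $ i - \<alpha> * g $ i)) - xs))\<^sup>2
    \<le> (1 - 2 * \<mu> * \<alpha>) * (norm (x - xs))\<^sup>2
      + \<alpha> * (2 * D * norm (g - F x) + \<alpha> * (G + norm (g - F x))\<^sup>2)"
proof -
  define e where "e = g - F x"
  have "norm ((\<chi> i. closest_point (\<Omega> i) (x $ i - \<alpha> * g $ i)) - xs) \<le> norm ((x - xs) - \<alpha> *\<^sub>R g)"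
  proof (rule norm_le_componentwise_cart)
    fix i
    have xi: "xs $ i \<in> \<Omega> i" using xs by (simp add: action_profiles_def)
    have "dist (closest_point (\<Omega> i) (x $ i - \<alpha> * g $ i)) (closest_point (\<Omega> i) (xs $ i))
        \<le> dist (x $ i - \<alpha> * g $ i) (xs $ i)"
      by (rule closest_point_lipschitz) (use \<Omega> xi in auto)
    then show "norm (((\<chi> i. closest_point (\<Omega> i) (x $ i - \<alpha> * g $ i)) - xs) $ i)
        \<le> norm (((x - xs) - \<alpha> *\<^sub>R g) $ i)"
      using xi by (simp add: closest_point_self dist_real_def algebra_simps)
  qed
  then have "(norm ((\<chi> i. closest_point (\<Omega> i) (x $ i - \<alpha> * g $ i)) - xs))\<^sup>2
      \<le> (norm ((x - xs) - \<alpha> *\<^sub>R g))\<^sup>2" by (intro power_mono) auto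
  also have "\<dots> = (norm (x - xs))\<^sup>2 - 2 * \<alpha> * (g \<bullet> (x - xs)) + \<alpha> * (\<alpha> * (norm g)\<^sup>2)"
    by (simp only: power2_norm_eq_inner) (simp add: inner_diff_left inner_diff_right inner_commute algebra_simps)
  also have "\<dots> \<le> (norm (x - xs))\<^sup>2 - 2 * \<alpha> * (\<mu> * (norm (x - xs))\<^sup>2 - D * norm e)
      + \<alpha> * (\<alpha> * (G + norm e)\<^sup>2)"
  proof (intro add_mono diff_left_mono mult_left_mono power_mono)
    have "\<mu> * (norm (x - xs))\<^sup>2 \<le> (F x - F xs) \<bullet> (x - xs)"
      using mono x xs by (simp add: strongly_monotone_on_def)
    moreover have "\<bar>e \<bullet> (x - xs)\<bar> \<le> norm e * D"
      using Cauchy_Schwarz_ineq2[of e "x - xs"] mult_left_mono[OF bounds(1), of "norm e"] by simp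
    moreover have "g \<bullet> (x - xs) = (F x - F xs) \<bullet> (x - xs) + F xs \<bullet> (x - xs) + e \<bullet> (x - xs)"
      by (simp add: e_def inner_diff_left)
    ultimately show "\<mu> * (norm (x - xs))\<^sup>2 - D * norm e \<le> g \<bullet> (x - xs)"
      using solution by (simp add: mult.commute)
    show "norm g \<le> G + norm e"
      using norm_triangle_sub[of g "F x"] bounds(2) by (simp add: e_def)
  qed (use \<open>0 \<le> \<alpha>\<close> in auto)
  also have "\<dots> = (1 - 2 * \<mu> * \<alpha>) * (norm (x - xs))\<^sup>2 + \<alpha> * (2 * D * norm e + \<alpha> * (G + norm e)\<^sup>2)"
    by (simp add: algebra_simps)
  finally show ?thesis by (simp add: e_def)
qed

text \<open>A statement about a single trajectory: it suffices that the gradient errors vanish, at whatever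
rate, because the relative weight of the error term in the recursion then tends to \<open>0\<close>.\<close>

lemma projected_gradient_converges:
  fixes x g :: "nat \<Rightarrow> real^'n"
  assumes \<Omega>: "\<And>i. convex (\<Omega> i)" "\<And>i. closed (\<Omega> i)"
    and "compact (action_profiles \<Omega>)" "continuous_on (action_profiles \<Omega>) F"
    and \<mu>: "0 < \<mu>" "strongly_monotone_on \<mu> (action_profiles \<Omega>) F"
    and xs: "xs \<in> action_profiles \<Omega>" "\<And>y. y \<in> action_profiles \<Omega> \<Longrightarrow> 0 \<le> F xs \<bullet> (y - xs)"
    and x: "\<And>k. x k \<in> action_profiles \<Omega>"
    and step: "\<And>k. x (Suc k) = (\<chi> i. closest_point (\<Omega> i) (x k $ i - \<alpha> k * g k $ i))"
    and \<alpha>: "\<And>k. 0 \<le> \<alpha> k" "\<alpha> \<longlonglongrightarrow> 0" "filterlim (\<lambda>n. \<Sum>k<n. \<alpha> k) at_top sequentially"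
    and error: "\<And>i. (\<lambda>k. g k $ i - F (x k) $ i) \<longlonglongrightarrow> 0"
  shows "(\<lambda>k. norm (x k - xs)) \<longlonglongrightarrow> 0"
proof -
  obtain D where D: "\<And>y. y \<in> action_profiles \<Omega> \<Longrightarrow> norm (y - xs) \<le> D"
    using bounded_any_center[of "action_profiles \<Omega>" xs] compact_imp_bounded[OF assms(3)]
    by (auto simp: dist_norm norm_minus_commute)
  obtain G where G: "\<And>y. y \<in> action_profiles \<Omega> \<Longrightarrow> norm (F y) \<le> G"
    using compact_imp_bounded[OF compact_continuous_image[OF assms(4,3)]]
    by (auto simp: bounded_iff)
  define e where "e = (\<lambda>k. norm (g k - F (x k)))"
  have "(\<lambda>k. g k - F (x k)) \<longlonglongrightarrow> 0"
    using error by (intro vec_tendstoI) simp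
  then have e: "e \<longlonglongrightarrow> 0" unfolding e_def by (rule tendsto_norm_zero)
  have "(\<lambda>k. (norm (x k - xs))\<^sup>2) \<longlonglongrightarrow> 0"
  proof (rule vanishing_recursion[where \<alpha> = \<alpha> and \<eta> = "\<lambda>k. 2 * D * e k + \<alpha> k * (G + e k)\<^sup>2"])
    show "0 < 2 * \<mu>" using \<mu> by simp
    have "(\<lambda>k. 2 * D * e k + \<alpha> k * (G + e k)\<^sup>2) \<longlonglongrightarrow> 2 * D * 0 + 0 * (G + 0)\<^sup>2"
      by (intro tendsto_intros e \<alpha>(2))
    then show "(\<lambda>k. 2 * D * e k + \<alpha> k * (G + e k)\<^sup>2) \<longlonglongrightarrow> 0" by simp
    show "eventually (\<lambda>k. (norm (x (Suc k) - xs))\<^sup>2 \<le> (1 - 2 * \<mu> * \<alpha> k) * (norm (x k - xs))\<^sup>2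
        + \<alpha> k * (2 * D * e k + \<alpha> k * (G + e k)\<^sup>2)) sequentially"
      unfolding step e_def
      by (intro always_eventually allI projected_gradient_step_le) (use assms D G in auto)
  qed (use \<alpha> in auto)
  from tendsto_real_sqrt[OF this] show ?thesis by simp
qed

section \<open>Step sizes and block parameters\<close>

lemma step_size_nonneg: "0 < b \<Longrightarrow> 0 \<le> step_size a b k"
  by (simp add: step_size_def)

lemma step_size_tendsto_0:
  assumes "0 < a"
  shows "step_size a b \<longlonglongrightarrow> 0"
proof -
  have "((\<lambda>k. b * (real k + 1) powr (- a)) \<longlongrightarrow> b * 0) sequentially"
    using assms by (intro tendsto_mult tendsto_const tendsto_neg_powr) (auto, real_asymp)
  then show ?thesis by (simp add: step_size_def[abs_def])
qed

lemma step_size_sum_diverges: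
  assumes "a \<le> 1" "0 < b"
  shows "filterlim (\<lambda>n. \<Sum>k<n. step_size a b k) at_top sequentially"
proof (rule filterlim_at_top_mono)
  show "filterlim (\<lambda>n. b * harm n :: real) at_top sequentially"
    by (rule filterlim_tendsto_pos_mult_at_top[OF tendsto_const \<open>0 < b\<close> harm_at_top])
  have "b / (real k + 1) \<le> step_size a b k" for k
  proof -
    have "(real k + 1) powr (- 1) \<le> (real k + 1) powr (- a)"
      using assms by (intro powr_mono) auto
    then show ?thesis
      using assms by (simp add: step_size_def powr_minus divide_inverse mult_left_mono)
  qed
  then have "b * harm n \<le> (\<Sum>k<n. step_size a b k)" for n
    unfolding harm_altdef sum_distrib_left
    by (intro sum_mono) (simp add: divide_inverse add.commute)
  then show "eventually (\<lambda>n. b * harm n \<le> (\<Sum>k<n. step_size a b k)) sequentially" by simp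
qed

lemma sample_size_ge:
  assumes "1 \<le> c"
  shows "(real k + 1) powr \<beta> \<le> real (sample_size c \<beta> k)"
proof -
  let ?q = "(real k + 1) powr \<beta>"
  have "?q \<le> real (nat \<lceil>?q\<rceil>)" by (simp add: real_nat_ceiling_ge)
  also have "\<dots> \<le> real c * real (nat \<lceil>?q\<rceil>)"
    using assms mult_right_mono[of 1 "real c" "real (nat \<lceil>?q\<rceil>)"] by simp
  finally show ?thesis by (simp add: sample_size_def)
qed

lemma num_blocks_pos: "0 < num_blocks c \<beta> k"
  by (simp add: num_blocks_def)

text \<open>\<open>m\<^sub>k / 2\<close> grows like a power of \<open>k\<close> and the other entry of the minimum like a logarithm, so that the
cap \<open>m\<^sub>k / 2\<close> is active for finitely many \<open>k\<close> only.\<close>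

lemma eventually_num_blocks:
  assumes "0 < \<beta>" "1 \<le> c"
  shows "eventually (\<lambda>k. num_blocks c \<beta> k = nat \<lfloor>1 + 16 * ln (real k + 1)\<rfloor> \<and>
      block_size c \<beta> k = nat \<lfloor>real (sample_size c \<beta> k) / real (num_blocks c \<beta> k)\<rfloor>) sequentially"
proof -
  have "eventually (\<lambda>k. 1 + 16 * ln (real k + 1) \<le> (real k + 1) powr \<beta> / 2) sequentially"
    using assms by real_asymp
  then show ?thesis
  proof eventually_elim
    case (elim k)
    have "8 * ln (exp (1 / 8) * inverse (failure_level k)) = 1 + 16 * ln (real k + 1)"
      by (simp add: failure_level_def ln_mult ln_realpow)
    then have raw: "raw_num_blocks c \<beta> k = nat \<lfloor>1 + 16 * ln (real k + 1)\<rfloor>"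
      using elim sample_size_ge[OF assms(2), of k \<beta>] by (simp add: raw_num_blocks_def)
    have "1 \<le> \<lfloor>1 + 16 * ln (real k + 1)\<rfloor>" by simp
    then have "raw_num_blocks c \<beta> k \<noteq> 0" unfolding raw by linarith
    then show ?case by (simp add: num_blocks_def block_size_def raw)
  qed
qed

text \<open>The factor \<open>exp (1/8)\<close> inside the logarithm adds the \<open>1\<close> that rounding down may lose.\<close>

lemma eventually_exp_num_blocks_le:
  assumes "0 < \<beta>" "1 \<le> c"
  shows "eventually (\<lambda>k. exp (- real (num_blocks c \<beta> k) / 8) \<le> failure_level k) sequentially"
  using eventually_num_blocks[OF assms]
proof eventually_elim
  case (elim k)
  have "1 + 16 * ln (real k + 1) < real (num_blocks c \<beta> k) + 1"
  proof -
    have "0 \<le> \<lfloor>1 + 16 * ln (real k + 1)\<rfloor>" by simp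
    then have "real (num_blocks c \<beta> k) = of_int \<lfloor>1 + 16 * ln (real k + 1)\<rfloor>"
      using elim by linarith
    then show ?thesis by linarith
  qed
  then have "exp (- real (num_blocks c \<beta> k) / 8) \<le> exp (- (2 * ln (real k + 1)))"
    by simp
  also have "\<dots> = failure_level k"
    by (simp add: failure_level_def exp_minus divide_inverse power2_eq_square exp_double)
  finally show ?case .
qed

lemma summable_failure_level: "summable failure_level"
proof -
  have "summable (\<lambda>k. 1 / (real (Suc k))\<^sup>2)"
    using inverse_power_summable[of 2, where 'a = real]
    by (subst summable_Suc_iff) (simp add: divide_inverse)
  then show ?thesis by (simp add: failure_level_def[abs_def] add.commute)
qed

text \<open>A power of \<open>k\<close> samples is shared by logarithmically many blocks.\<close>

lemma block_size_at_top:
  assumes "0 < \<beta>" "1 \<le> c"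
  shows "filterlim (block_size c \<beta>) at_top sequentially"
proof (rule filterlim_at_top_mono)
  show "filterlim (\<lambda>k. nat \<lfloor>(real k + 1) powr \<beta> / (1 + 16 * ln (real k + 1))\<rfloor>) at_top sequentially"
  proof (rule filterlim_compose[OF filterlim_nat_sequentially])
    have "filterlim (\<lambda>k. (real k + 1) powr \<beta> / (1 + 16 * ln (real k + 1))) at_top sequentially"
      using assms by real_asymp
    then show "filterlim (\<lambda>k. \<lfloor>(real k + 1) powr \<beta> / (1 + 16 * ln (real k + 1))\<rfloor>) at_top sequentially"
      by (rule filterlim_compose[OF filterlim_floor_sequentially])
  qed
  show "eventually (\<lambda>k. nat \<lfloor>(real k + 1) powr \<beta> / (1 + 16 * ln (real k + 1))\<rfloor> \<le> block_size c \<beta> k) sequentially"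
    using eventually_num_blocks[OF assms]
  proof eventually_elim
    case (elim k)
    have "0 \<le> ln (real k + 1)" by simp
    then have "real (num_blocks c \<beta> k) \<le> 1 + 16 * ln (real k + 1)"
      using elim by simp
    then have "(real k + 1) powr \<beta> / (1 + 16 * ln (real k + 1))
        \<le> real (sample_size c \<beta> k) / real (num_blocks c \<beta> k)"
      using sample_size_ge[OF assms(2), of k \<beta>] num_blocks_pos[of c \<beta> k] by (intro frac_le) auto
    then show ?case using elim by (simp add: nat_mono floor_mono)
  qed
qed

section \<open>Adaptedness of the iterates\<close>

lemma borel_measurable_vec_lambda:
  fixes g :: "'n::finite \<Rightarrow> 'a \<Rightarrow> real"
  assumes "\<And>i. g i \<in> borel_measurable N"
  shows "(\<lambda>\<omega>. \<chi> i. g i \<omega>) \<in> borel_measurable N"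
  by (subst borel_measurable_euclidean_space) (use assms in \<open>auto simp: Basis_vec_def inner_axis\<close>)

lemma sets_past_mono: "k \<le> k' \<Longrightarrow> sets (past M m \<zeta> k) \<subseteq> sets (past M m \<zeta> k')"
  unfolding past_def
  by (intro sets_generated_by_subset measurable_generated_by) auto

lemma space_past [simp]: "space (past M m \<zeta> k) = space M"
  by (simp add: past_def)

lemma measurable_past:
  assumes "t < k" "j < m t"
  shows "\<zeta> i t j \<in> borel_measurable (past M m \<zeta> k)"
  using measurable_generated_by[of "(i, t, j)" "{(i, t, j). t < k \<and> j < m t}" "\<lambda>(i, t, j). \<zeta> i t j"] assms
  unfolding past_def by simp

lemma subalgebra_past:
  assumes "\<And>i t j. j < m t \<Longrightarrow> \<zeta> i t j \<in> borel_measurable M"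
  shows "subalgebra M (past M m \<zeta> k)"
  unfolding subalgebra_def
proof
  show "sets (past M m \<zeta> k) \<subseteq> sets M"
    unfolding past_def by (rule sets_generated_by_subset) (use assms in auto)
qed simp

lemma iterates_in_action_profiles:
  assumes "\<And>i. closed (\<Omega> i)" "x0 \<in> action_profiles \<Omega>"
  shows "iterates \<Omega> f \<alpha> n s B \<zeta> x0 k \<omega> \<in> action_profiles \<Omega>"
proof (induction k)
  case (Suc k)
  have "\<Omega> i \<noteq> {}" for i using assms(2) by (auto simp: action_profiles_def)
  then show ?case
    using assms(1) by (simp add: Let_def action_profiles_def closest_point_in_set)
qed (use assms in simp)

text \<open>By induction: the step from \<open>k\<close> to \<open>k + 1\<close> reads only samples drawn at step \<open>k\<close>, which belong to the
past of step \<open>k + 1\<close>. The target is the space of profiles, since the sample gradient is jointly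
measurable there.\<close>

lemma iterates_measurable_past:
  fixes \<Omega> :: "'n::finite \<Rightarrow> real set"
  assumes \<Omega>: "\<And>i. convex (\<Omega> i)" "\<And>i. closed (\<Omega> i)" and x0: "x0 \<in> action_profiles \<Omega>"
    and gradient: "\<And>i. (\<lambda>(x, z). sample_gradient f i x z)
      \<in> borel_measurable (restrict_space borel (action_profiles \<Omega>) \<Otimes>\<^sub>M borel)"
    and blocks: "\<And>i k. valid_blocks (m k) (n k) (s k) (B i k)"
  shows "iterates \<Omega> f \<alpha> n s B \<zeta> x0 k
    \<in> measurable (past M m \<zeta> k) (restrict_space borel (action_profiles \<Omega>))"
proof (induction k)
  case 0
  then show ?case using x0 by (simp add: space_restrict_space)
next
  case (Suc k)
  let ?X = "iterates \<Omega> f \<alpha> n s B \<zeta> x0" and ?P = "past M m \<zeta> (Suc k)"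
  have X: "?X k \<in> measurable ?P (restrict_space borel (action_profiles \<Omega>))"
    using Suc sets_past_mono[of k "Suc k" M m \<zeta>]
    by (auto simp: measurable_def)
  have X_borel: "?X k \<in> borel_measurable ?P"
    using X by (simp add: measurable_restrict_space2_iff)
  have "(\<lambda>\<omega>. sample_gradient f i (?X k \<omega>) (\<zeta> i k j \<omega>)) \<in> borel_measurable ?P" if "j < m k" for i j
    using measurable_compose[OF measurable_Pair[OF X measurable_past[where t = k and k = "Suc k"
        and j = j and m = m and \<zeta> = \<zeta> and i = i]] gradient[of i]] that
    by simp
  then have MoM: "(\<lambda>\<omega>. median_of_means (n k) (s k) (B i k)
      (\<lambda>j. sample_gradient f i (?X k \<omega>) (\<zeta> i k j \<omega>))) \<in> borel_measurable ?P" for i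
    by (rule borel_measurable_median_of_means[OF blocks])
  have proj: "closest_point (\<Omega> i) \<in> borel_measurable borel" for i
    by (intro borel_measurable_continuous_onI continuous_on_closest_point)
      (use \<Omega> x0 in \<open>auto simp: action_profiles_def\<close>)
  have "(\<lambda>\<omega>. ?X k \<omega> $ i - \<alpha> k * median_of_means (n k) (s k) (B i k)
      (\<lambda>j. sample_gradient f i (?X k \<omega>) (\<zeta> i k j \<omega>))) \<in> borel_measurable ?P" for i
    using MoM[of i] measurable_compose[OF X_borel borel_measurable_nth[of i]] by measurable
  then have "?X (Suc k) \<in> borel_measurable ?P"
    unfolding iterates.simps Let_def
    by (intro borel_measurable_vec_lambda measurable_compose[OF _ proj])
  moreover have "?X (Suc k) \<omega> \<in> action_profiles \<Omega>" for \<omega>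
    using \<Omega>(2) x0 by (rule iterates_in_action_profiles)
  ultimately show ?case
    by (intro measurable_restrict_space2) (auto simp del: iterates.simps)
qed

section \<open>Almost sure convergence\<close>

theorem theorem1:
  fixes M :: "'w measure"
    and \<Omega> :: "'n::finite \<Rightarrow> real set"
    and U :: "(real^'n) set"
    and f :: "'n \<Rightarrow> real^'n \<Rightarrow> real \<Rightarrow> real"
    and \<xi> :: "'n \<Rightarrow> 'w \<Rightarrow> real"
    and J :: "'n \<Rightarrow> real^'n \<Rightarrow> real"
    and F :: "real^'n \<Rightarrow> real^'n"
    and \<zeta> :: "'n \<Rightarrow> nat \<Rightarrow> nat \<Rightarrow> 'w \<Rightarrow> real"
    and B :: "'n \<Rightarrow> nat \<Rightarrow> nat \<Rightarrow> nat set"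
    and x0 :: "real^'n"
    and X :: "nat \<Rightarrow> 'w \<Rightarrow> real^'n"
    and \<epsilon> :: "'n \<Rightarrow> nat \<Rightarrow> nat \<Rightarrow> 'w \<Rightarrow> real"
    and \<mu> L \<delta> \<nu> a b \<beta> :: real
    and c :: nat
  assumes players: "CARD('n) > 1"
    and prob: "prob_space M"
    and rv: "\<And>i. \<xi> i \<in> borel_measurable M"
    and J: "J = cost M f \<xi>"
    and F: "F = pseudo_gradient J"
    and U: "open U" "action_profiles \<Omega> \<subseteq> U"
    and J_finite: "\<And>i x. x \<in> U \<Longrightarrow> integrable M (\<lambda>\<omega>. f i x (\<xi> i \<omega>))"
    and f_diff: "\<And>i x. x \<in> action_profiles \<Omega> \<Longrightarrow>
          AE \<omega> in M. (\<lambda>t. f i (deviate x i t) (\<xi> i \<omega>)) field_differentiable (at (x $ i))"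
    and gradient_measurable: "\<And>i. (\<lambda>(x, z). sample_gradient f i x z)
          \<in> borel_measurable (restrict_space borel (action_profiles \<Omega>) \<Otimes>\<^sub>M borel)"
    and \<Omega>: "action_profiles \<Omega> \<noteq> {}" "convex (action_profiles \<Omega>)" "compact (action_profiles \<Omega>)"
    and C1: "\<And>i. continuously_differentiable_on U (J i)"
    and convex: "\<And>i x. (\<And>j. j \<noteq> i \<Longrightarrow> x $ j \<in> \<Omega> j) \<Longrightarrow> convex_on (\<Omega> i) (\<lambda>t. J i (deviate x i t))"
    and strongly_monotone: "\<mu> > 0" "strongly_monotone_on \<mu> (action_profiles \<Omega>) F"
    and lipschitz: "L > 0" "L-lipschitz_on (action_profiles \<Omega>) F"
    and step: "0 < a" "a \<le> 1" "b > 0"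
    and sample: "\<beta> > 0" "c \<ge> 1"
    and samples: "fresh_samples M \<xi> (sample_size c \<beta>) \<zeta>"
    and blocks: "\<And>i k. valid_blocks (sample_size c \<beta> k) (num_blocks c \<beta> k) (block_size c \<beta> k) (B i k)"
    and x0: "x0 \<in> action_profiles \<Omega>"
    and X: "X = iterates \<Omega> f (step_size a b) (num_blocks c \<beta>) (block_size c \<beta>) B \<zeta> x0"
    and noise: "\<And>i k j \<omega>. \<epsilon> i k j \<omega> =
          sample_gradient f i (X k \<omega>) (\<zeta> i k j \<omega>) - partial_deriv (J i) i (X k \<omega>)"
    and unbiased: "\<And>i k j. j < sample_size c \<beta> k \<Longrightarrow>
          AE \<omega> in M. real_cond_exp M (past M (sample_size c \<beta>) \<zeta> k) (\<epsilon> i k j) \<omega> = 0"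
    and moment: "1 < \<delta>" "\<delta> \<le> 2" "\<nu> > 0"
          "\<And>i k j. j < sample_size c \<beta> k \<Longrightarrow>
             AE \<omega> in M. nn_cond_exp M (past M (sample_size c \<beta>) \<zeta> k)
                           (\<lambda>\<omega>. ennreal (\<bar>\<epsilon> i k j \<omega>\<bar> powr \<delta>)) \<omega> \<le> ennreal (\<nu> powr \<delta>)"
  shows "(\<exists>!xs. nash_equilibrium \<Omega> J xs) \<and>
         (\<forall>xs. nash_equilibrium \<Omega> J xs \<longrightarrow>
            (AE \<omega> in M. (\<lambda>k. norm (X k \<omega> - xs)) \<longlonglongrightarrow> 0))"
proof -
  interpret prob_space M by (rule prob)
  let ?S = "action_profiles \<Omega>" and ?m = "sample_size c \<beta>"
    and ?n = "num_blocks c \<beta>" and ?s = "block_size c \<beta>"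
  let ?P = "past M ?m \<zeta>"
  note \<Omega>_i = action_set_convex_compact[OF \<Omega>]
  have closed: "closed (\<Omega> i)" for i using \<Omega>_i(3) by (rule compact_imp_closed)
  have F_nth: "F x $ i = partial_deriv (J i) i x" for x i
    by (simp add: F pseudo_gradient_def)
  have F_cont: "continuous_on ?S F" using lipschitz(2) by (rule lipschitz_on_continuous_on)

  have deriv: "((\<lambda>t. J i (deviate x i t)) has_real_derivative pseudo_gradient J x $ i) (at (x $ i))"
    if "x \<in> ?S" for i x
  proof -
    obtain G where "\<forall>x\<in>U. GDERIV (J i) x :> G x"
      using C1[of i] unfolding continuously_differentiable_on_def by blast
    then show ?thesis
      using has_partial_deriv[of "J i" x "G x" i] U(2) that by (auto simp: pseudo_gradient_def)
  qed
  have nash: "nash_equilibrium \<Omega> J x \<longleftrightarrow> x \<in> ?S \<and> (\<forall>y\<in>?S. 0 \<le> F x \<bullet> (y - x))" for x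
    unfolding F using deriv convex
    by (intro nash_equilibrium_iff_variational) (auto simp: action_profiles_def)
  have "\<exists>!xs. nash_equilibrium \<Omega> J xs"
    using variational_solution_exists[OF \<Omega> F_cont] variational_solution_unique[OF strongly_monotone]
    unfolding nash by blast
  moreover have "AE \<omega> in M. (\<lambda>k. norm (X k \<omega> - xs)) \<longlonglongrightarrow> 0" if xs: "nash_equilibrium \<Omega> J xs" for xs
  proof -
    \<comment> \<open>\<open>g i k\<close> is the gradient estimate that player \<open>i\<close> uses at step \<open>k\<close>.\<close>
    define g where "g = (\<lambda>i k \<omega>. median_of_means (?n k) (?s k) (B i k)
      (\<lambda>j. sample_gradient f i (X k \<omega>) (\<zeta> i k j \<omega>)))"
    have \<zeta>: "\<zeta> i k j \<in> borel_measurable M" if "j < ?m k" for i k j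
      using samples that by (simp add: fresh_samples_def)
    have sub: "subalgebra M (?P k)" for k
      using \<zeta> by (rule subalgebra_past)
    have X_in: "X k \<omega> \<in> ?S" for k \<omega>
      unfolding X using closed x0 by (rule iterates_in_action_profiles)
    have X_meas: "X k \<in> measurable (?P k) (restrict_space borel ?S)" for k
      unfolding X by (rule iterates_measurable_past[OF \<Omega>_i(2) closed x0 gradient_measurable blocks])
    have F_meas: "(\<lambda>\<omega>. F (X k \<omega>) $ i) \<in> borel_measurable (?P k)" for i k
      using measurable_compose[OF X_meas borel_measurable_continuous_on_restrict[OF F_cont]]
      by (rule measurable_compose[OF _ borel_measurable_nth])
    have gradient: "(\<lambda>(\<omega>, z). sample_gradient f i (X k \<omega>) z) \<in> borel_measurable (?P k \<Otimes>\<^sub>M borel)" for i k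
      using measurable_compose[OF measurable_Pair[OF measurable_compose[OF measurable_fst X_meas] measurable_snd]
        gradient_measurable[of i]] by (simp add: split_beta)
    have eps: "\<epsilon> i k j = (\<lambda>\<omega>. sample_gradient f i (X k \<omega>) (\<zeta> i k j \<omega>) - F (X k \<omega>) $ i)" for i k j
      by (simp add: fun_eq_iff noise F_nth)

    \<comment> \<open>Borel-Cantelli for a fixed tolerance \<open>t\<close>; the tolerances \<open>1 / (p + 1)\<close> are combined below.\<close>
    have error_small: "AE \<omega> in M. eventually (\<lambda>k. \<bar>g i k \<omega> - F (X k \<omega>) $ i\<bar> \<le> t) sequentially"
      if "0 < t" for i t
    proof -
      let ?bad = "\<lambda>k. {\<omega> \<in> space M. g i k \<omega> \<notin> {F (X k \<omega>) $ i - t..F (X k \<omega>) $ i + t}}"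
      obtain T s\<^sub>0 where T: "0 < T" and "0 < s\<^sub>0"
        and accuracy: "\<And>s. s\<^sub>0 \<le> s \<Longrightarrow> 2 * T / sqrt (real s) + 2 * (\<nu> powr \<delta>) * T powr (1 - \<delta>) \<le> t / 4"
        using truncation_level_exists[of \<delta> "t / 4" "\<nu> powr \<delta>"] moment(1) \<open>0 < t\<close> by auto
      have dev: "?bad k \<in> events \<and> prob (?bad k) \<le> exp (- real (?n k) / 8)" if s: "s\<^sub>0 \<le> ?s k" for k
      proof -
        have "0 < ?s k" using s \<open>0 < s\<^sub>0\<close> by simp
        have fresh: "indep_vars (\<lambda>_. borel) (\<zeta> i k) {..<?m k}"
          "indep_set (sets (?P k)) (sets (generated_by M (\<zeta> i k) {..<?m k}))"
          using samples by (simp_all add: fresh_samples_def)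
        note deviation = median_of_means_conditional_deviation[OF moment(1) \<open>0 < t\<close> powr_ge_zero T \<open>0 < ?s k\<close>
          num_blocks_pos accuracy[OF s] blocks sub \<zeta> fresh gradient F_meas
          unbiased[unfolded eps] moment(4)[unfolded eps]]
        show ?thesis unfolding g_def using deviation by blast
      qed
      have "eventually (\<lambda>k. s\<^sub>0 \<le> ?s k) sequentially"
        using block_size_at_top[OF sample] by (simp add: filterlim_at_top)
      then have "eventually (\<lambda>k. ?bad k \<in> events \<and> prob (?bad k) \<le> failure_level k) sequentially"
        using eventually_exp_num_blocks_le[OF sample]
        by eventually_elim (use dev in force)
      then obtain K where K: "\<And>k. K \<le> k \<Longrightarrow> ?bad k \<in> events \<and> prob (?bad k) \<le> failure_level k"
        unfolding eventually_sequentially by blast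
      \<comment> \<open>The bounds on \<open>?bad k\<close> hold from \<open>K\<close> on, so the sequence of events is shifted by \<open>K\<close>.\<close>
      have "summable (\<lambda>k. prob (?bad (k + K)))"
      proof (rule summable_comparison_test)
        show "\<exists>N. \<forall>k\<ge>N. norm (prob (?bad (k + K))) \<le> failure_level (k + K)"
          using K by simp
        show "summable (\<lambda>k. failure_level (k + K))"
          using summable_failure_level by (subst summable_iff_shift)
      qed
      from borel_cantelli_AE1[OF _ _ this]
      have "AE \<omega> in M. eventually (\<lambda>k. \<omega> \<in> space M - ?bad (k + K)) sequentially"
        using K by (simp add: emeasure_eq_measure)
      then show ?thesis
        using AE_space
      proof eventually_elim
        case (elim \<omega>)
        from elim(1) have "eventually (\<lambda>k. \<bar>g i (k + K) \<omega> - F (X (k + K) \<omega>) $ i\<bar> \<le> t) sequentially"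
          by eventually_elim (auto simp: abs_le_iff)
        then show ?case by (rule eventually_sequentially_seg[THEN iffD1])
      qed
    qed
    have "AE \<omega> in M. \<forall>i. \<forall>p. eventually (\<lambda>k. \<bar>g i k \<omega> - F (X k \<omega>) $ i\<bar> \<le> inverse (real (Suc p))) sequentially"
      by (intro AE_all_countable[THEN iffD2] allI error_small) simp
    then show ?thesis
    proof eventually_elim
      case (elim \<omega>)
      show ?case
      proof (rule projected_gradient_converges[where g = "\<lambda>k. \<chi> i. g i k \<omega>"])
        show "X (Suc k) \<omega> = (\<chi> i. closest_point (\<Omega> i) (X k \<omega> $ i - step_size a b k * (\<chi> i. g i k \<omega>) $ i))" for k
          by (simp add: X g_def Let_def)
        show "(\<lambda>k. (\<chi> i. g i k \<omega>) $ i - F (X k \<omega>) $ i) \<longlonglongrightarrow> 0" for i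
        proof (rule LIMSEQ_I)
          fix r :: real assume "0 < r"
          then obtain p where p: "inverse (real (Suc p)) < r" using reals_Archimedean by blast
          from elim obtain K where "\<forall>k\<ge>K. \<bar>g i k \<omega> - F (X k \<omega>) $ i\<bar> \<le> inverse (real (Suc p))"
            unfolding eventually_sequentially by blast
          then show "\<exists>K. \<forall>k\<ge>K. norm ((\<chi> i. g i k \<omega>) $ i - F (X k \<omega>) $ i - 0) < r"
            using p by (intro exI[of _ K]) (auto intro: le_less_trans)
        qed
        show "strongly_monotone_on \<mu> ?S F" "0 < \<mu>" by (fact strongly_monotone)+
        show "xs \<in> ?S" "\<And>y. y \<in> ?S \<Longrightarrow> 0 \<le> F xs \<bullet> (y - xs)"
          using xs by (auto simp: nash)
        show "step_size a b \<longlonglongrightarrow> 0" using step(1) by (rule step_size_tendsto_0)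
        show "filterlim (\<lambda>n. \<Sum>k<n. step_size a b k) at_top sequentially"
          using step(2,3) by (rule step_size_sum_diverges)
        show "0 \<le> step_size a b k" for k using step(3) by (rule step_size_nonneg)
      qed (use \<Omega>_i(2) closed \<Omega>(3) F_cont X_in in auto)
    qed
  qed
  ultimately show ?thesis by blast
qed

end
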